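(* In the setting described in the context (a Morse function $f$ on a Riemannian manifold $(X,g)$ such that the spaces $\mathcal G_{a'}^{b'}$ are compact for all $a'\le b'$, fixed $a<b$, and data $U$, $\mathcal N$, $\delta$, $k$), there exists $\varepsilon\in(0,\delta)$ such that for all $v\in\mathcal V^k$ with $\|v\|_{C^k}<\varepsilon$, $$x(\mathbb R)\subset\mathcal N\qquad\text{for all }x\in\mathcal G_a^b(v,\overline{\mathcal N}).$$
   Context: $X$ is a connected smooth finite-dimensional manifold (not necessarily compact or complete), $g$ a Riemannian metric on $X$, $f\colon X\to\mathbb R$ a smooth Morse function, $\nabla f$ its $g$-gradient. For $a'\le b'$ let $\mathcal G_{a'}^{b'}$ be the set of $x\in C^\infty(\mathbb R,X)$ with $\dot x(s)=-\nabla f(x(s))$ and $a'\le f(x(s))\le b'$ for all $s\in\mathbb R$. Standing assumption: for all $a'\le b'$, $\mathcal G_{a'}^{b'}$ is compact in $C^\infty(\mathbb R,X)$ with the $C^\infty_{\mathrm{loc}}$-topology. Consequently the set $\mathrm{Crit}f_a^b$ of critical points $x$ of $f$ with $a\le f(x)\le b$ is finite. Fix $a<b$ and let $c_1,\dots,c_m$ be the elements of $\mathrm{Crit}f_a^b$. Choose open neighbourhoods $U_i$ of $c_i$ with pairwise disjoint closures and put $U=\bigcup_iU_i$. The set $K=\{x(0)\mid x\in\mathcal G_a^b\}\subset X$ is compact. Choose an open and bounded neighbourhood $\mathcal N$ of $K$ in $X$ and $\delta>0$ with $\|\nabla f(x)\|\ge\delta$ for all $x\in\mathcal N\setminus U$.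 Choose $k\in\mathbb N$ with $k\ge2$ and $k>\mathrm{ind}(c_i)-\mathrm{ind}(c_j)$ for all $i,j$ (Morse indices). $\mathcal V^k$ is the Banach space, with the $C^k$-norm, of $C^k$-vector fields on $X$ that vanish on $U$ and have bounded derivatives up to order $k$. For $v\in\mathcal V^k$, $\mathcal G_a^b(v,\overline{\mathcal N})$ is the set of solutions $x\colon\mathbb R\to X$ of $\dot x(s)=-\nabla f(x(s))+v(x(s))$ with $a\le f(x(s))\le b$ and $x(s)\in\overline{\mathcal N}$ for all $s\in\mathbb R$.
   Formalization: The "bounded" neighbourhood 𝒩 is required to have compact closure in X; when X is incomplete, the claim fails for 𝒩 that is merely bounded in the Riemannian distance, and when X is complete the two conditions agree. *)

theory Defs
  imports "HOL-Analysis.Analysis"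
begin

section \<open>Differentiability classes in normed spaces\<close>

text \<open>On an open subset of a finite-dimensional space, \<open>C\<^sup>k\<close> in the usual sense: all iterated
  directional derivatives up to order \<open>k\<close> exist as Frechet derivatives and are continuous.\<close>

fun Ck_on :: "nat \<Rightarrow> ('p::real_normed_vector \<Rightarrow> 'q::real_normed_vector) \<Rightarrow> 'p set \<Rightarrow> bool" where
  "Ck_on 0 h S \<longleftrightarrow> continuous_on S h"
| "Ck_on (Suc k) h S \<longleftrightarrow>
     (\<forall>p\<in>S. h differentiable (at p)) \<and> (\<forall>w. Ck_on k (\<lambda>p. frechet_derivative h (at p) w) S)"

definition smooth_on :: "('p::real_normed_vector \<Rightarrow> 'q::real_normed_vector) \<Rightarrow> 'p set \<Rightarrow> bool" where
  "smooth_on h S \<longleftrightarrow> (\<forall>k. Ck_on k h S)"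


section \<open>Smooth manifolds\<close>

text \<open>The model space \<open>'e\<close> is a finite-dimensional normed space of arbitrary dimension. The class
  \<open>euclidean_space\<close> is avoided only because it excludes dimension 0; the sort
  \<open>{banach, heine_borel}\<close> is satisfied by every finite-dimensional normed space.\<close>

type_synonym ('a, 'e) chart = "'a set \<times> ('a \<Rightarrow> 'e)"

abbreviation cdom :: "('a, 'e) chart \<Rightarrow> 'a set" where
  "cdom c \<equiv> fst c"

abbreviation cmap :: "('a, 'e) chart \<Rightarrow> 'a \<Rightarrow> 'e" where
  "cmap c \<equiv> snd c"

abbreviation cinv :: "('a, 'e) chart \<Rightarrow> 'e \<Rightarrow> 'a" where
  "cinv c \<equiv> inv_into (cdom c) (cmap c)"

definition is_chart :: "('a::topological_space, 'e::real_normed_vector) chart \<Rightarrow> bool" where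
  "is_chart c \<longleftrightarrow> open (cdom c) \<and> open (cmap c ` cdom c) \<and>
     homeomorphism (cdom c) (cmap c ` cdom c) (cmap c) (cinv c)"

definition smooth_manifold ::
  "('a::{t2_space, second_countable_topology}, 'e::{banach, heine_borel}) chart set \<Rightarrow> bool" where
  "smooth_manifold A \<longleftrightarrow>
     (\<exists>B::'e set. finite B \<and> span B = UNIV) \<and>
     (\<forall>c\<in>A. is_chart c) \<and>
     (\<Union>c\<in>A. cdom c) = UNIV \<and>
     (\<forall>c\<in>A. \<forall>d\<in>A. smooth_on (cmap d \<circ> cinv c) (cmap c ` (cdom c \<inter> cdom d)))"

definition smooth_function ::
  "('a, 'e::{banach, heine_borel}) chart set \<Rightarrow> ('a \<Rightarrow> real) \<Rightarrow> bool" where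
  "smooth_function A f \<longleftrightarrow> (\<forall>c\<in>A. smooth_on (f \<circ> cinv c) (cmap c ` cdom c))"

text \<open>A tangent vector at \<open>x\<close> is given by its components in the charts around \<open>x\<close>, which transform
  by the Jacobian of the coordinate change. A vector field \<open>v\<close> therefore assigns to a chart \<open>c\<close>
  and a point \<open>x\<close> of its domain the component vector \<open>v c x\<close>; likewise for tensors. Values at
  points outside the domain of \<open>c\<close> carry no meaning.\<close>

definition jacobian :: "('a, 'e::real_normed_vector) chart \<Rightarrow> ('a, 'e) chart \<Rightarrow> 'a \<Rightarrow> 'e \<Rightarrow> 'e" where
  "jacobian c d x = frechet_derivative (cmap d \<circ> cinv c) (at (cmap c x))"

type_synonym ('a, 'e) vfield = "('a, 'e) chart \<Rightarrow> 'a \<Rightarrow> 'e"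

type_synonym ('a, 'e) metric = "('a, 'e) chart \<Rightarrow> 'a \<Rightarrow> 'e \<Rightarrow> 'e \<Rightarrow> real"

definition vector_field ::
  "('a, 'e::{banach, heine_borel}) chart set \<Rightarrow> ('a, 'e) vfield \<Rightarrow> bool" where
  "vector_field A v \<longleftrightarrow>
     (\<forall>c\<in>A. \<forall>d\<in>A. \<forall>x \<in> cdom c \<inter> cdom d. v d x = jacobian c d x (v c x))"

definition Ck_vector_field ::
  "nat \<Rightarrow> ('a, 'e::{banach, heine_borel}) chart set \<Rightarrow> ('a, 'e) vfield \<Rightarrow> bool" where
  "Ck_vector_field k A v \<longleftrightarrow>
     vector_field A v \<and> (\<forall>c\<in>A. Ck_on k (v c \<circ> cinv c) (cmap c ` cdom c))"


section \<open>Riemannian metrics\<close>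

definition riemannian_metric ::
  "('a, 'e::{banach, heine_borel}) chart set \<Rightarrow> ('a, 'e) metric \<Rightarrow> bool" where
  "riemannian_metric A g \<longleftrightarrow>
     (\<forall>c\<in>A. \<forall>x\<in>cdom c.
        bilinear (g c x) \<and> (\<forall>u w. g c x u w = g c x w u) \<and> (\<forall>u. u \<noteq> 0 \<longrightarrow> g c x u u > 0)) \<and>
     (\<forall>c\<in>A. \<forall>u w. smooth_on (\<lambda>p. g c (cinv c p) u w) (cmap c ` cdom c)) \<and>
     (\<forall>c\<in>A. \<forall>d\<in>A. \<forall>x \<in> cdom c \<inter> cdom d. \<forall>u w.
        g c x u w = g d x (jacobian c d x u) (jacobian c d x w))"

definition gnorm :: "('a, 'e) metric \<Rightarrow> ('a, 'e) chart \<Rightarrow> 'a \<Rightarrow> 'e \<Rightarrow> real" where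
  "gnorm g c x w = sqrt (g c x w w)"

definition differential ::
  "('a \<Rightarrow> real) \<Rightarrow> ('a, 'e::real_normed_vector) chart \<Rightarrow> 'a \<Rightarrow> 'e \<Rightarrow> real" where
  "differential f c x = frechet_derivative (f \<circ> cinv c) (at (cmap c x))"

definition gradient ::
  "('a, 'e::real_normed_vector) metric \<Rightarrow> ('a \<Rightarrow> real) \<Rightarrow> ('a, 'e) vfield" where
  "gradient g f c x = (THE z. \<forall>u. g c x z u = differential f c x u)"

text \<open>Christoffel symbols of the Levi-Civita connection: \<open>\<Gamma>(u, w)\<close> is the component vector of the
  covariant derivative of the coordinate-constant field \<open>w\<close> in the direction \<open>u\<close>.\<close>

definition christoffel ::
  "('a, 'e::real_normed_vector) metric \<Rightarrow> ('a, 'e) chart \<Rightarrow> 'a \<Rightarrow> 'e \<Rightarrow> 'e \<Rightarrow> 'e" where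
  "christoffel g c x u w =
     (let Dg = (\<lambda>r s t. frechet_derivative (\<lambda>p. g c (cinv c p) s t) (at (cmap c x)) r)
      in THE z. \<forall>y. g c x z y = (Dg u w y + Dg w u y - Dg y u w) / 2)"

text \<open>A tensor field \<open>T\<close> of type \<open>(1, j)\<close> is written in the chart \<open>c\<close> as a function taking the list
  of its \<open>j\<close> vector arguments and a point. Its covariant derivative is of type \<open>(1, j + 1)\<close>,
  the head of the list being the direction of differentiation.\<close>

definition covariant_derivative ::
  "('a, 'e::real_normed_vector) metric \<Rightarrow> ('a, 'e) chart \<Rightarrow>
     ('e list \<Rightarrow> 'a \<Rightarrow> 'e) \<Rightarrow> ('e list \<Rightarrow> 'a \<Rightarrow> 'e)" where
  "covariant_derivative g c T ws x =
     (let w = hd ws; us = tl ws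
      in frechet_derivative (T us \<circ> cinv c) (at (cmap c x)) w
         + christoffel g c x w (T us x)
         - (\<Sum>i<length us. T (us[i := christoffel g c x w (us ! i)]) x))"

definition nabla ::
  "('a, 'e::real_normed_vector) metric \<Rightarrow> nat \<Rightarrow> ('a, 'e) vfield \<Rightarrow>
     ('a, 'e) chart \<Rightarrow> 'e list \<Rightarrow> 'a \<Rightarrow> 'e" where
  "nabla g j v c = (covariant_derivative g c ^^ j) (\<lambda>_. v c)"

text \<open>The supremum of the following set is the supremum over \<open>x\<close> of the operator norm, with respect
  to \<open>g\<close>, of the multilinear map \<open>\<nabla>\<^sup>j v(x)\<close>; for \<open>j = 0\<close> it is the supremum of the pointwise norm
  of \<open>v\<close>.\<close>

definition nabla_values ::
  "('a, 'e::{banach, heine_borel}) chart set \<Rightarrow> ('a, 'e) metric \<Rightarrow> nat \<Rightarrow> ('a, 'e) vfield \<Rightarrow> real set"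
where
  "nabla_values A g j v =
     {gnorm g c x (nabla g j v c ws x) | c x ws.
        c \<in> A \<and> x \<in> cdom c \<and> length ws = j \<and> (\<forall>w\<in>set ws. gnorm g c x w \<le> 1)}"

definition Ck_norm ::
  "('a, 'e::{banach, heine_borel}) chart set \<Rightarrow> ('a, 'e) metric \<Rightarrow> nat \<Rightarrow> ('a, 'e) vfield \<Rightarrow> real"
where
  "Ck_norm A g k v = (\<Sum>j\<le>k. Sup (nabla_values A g j v))"

text \<open>The space \<open>\<V>\<^sup>k\<close>; boundedness of the derivatives makes the suprema in the norm meaningful.\<close>

definition Vk ::
  "('a, 'e::{banach, heine_borel}) chart set \<Rightarrow> ('a, 'e) metric \<Rightarrow> nat \<Rightarrow> 'a set \<Rightarrow> ('a, 'e) vfield set"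
where
  "Vk A g k U =
     {v. Ck_vector_field k A v \<and>
         (\<forall>c\<in>A. \<forall>x \<in> cdom c \<inter> U. v c x = 0) \<and>
         (\<forall>j\<le>k. bdd_above (nabla_values A g j v))}"


section \<open>Morse functions\<close>

definition critical_points ::
  "('a, 'e::{banach, heine_borel}) chart set \<Rightarrow> ('a \<Rightarrow> real) \<Rightarrow> 'a set" where
  "critical_points A f = {x. \<forall>c\<in>A. x \<in> cdom c \<longrightarrow> (\<forall>u. differential f c x u = 0)}"

text \<open>Meaningful, that is, independent of the chart up to the Jacobian, at critical points.\<close>

definition hessian ::
  "('a \<Rightarrow> real) \<Rightarrow> ('a, 'e::real_normed_vector) chart \<Rightarrow> 'a \<Rightarrow> 'e \<Rightarrow> 'e \<Rightarrow> real" where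
  "hessian f c x u w =
     frechet_derivative (\<lambda>p. frechet_derivative (f \<circ> cinv c) (at p) u) (at (cmap c x)) w"

definition morse_function ::
  "('a, 'e::{banach, heine_borel}) chart set \<Rightarrow> ('a \<Rightarrow> real) \<Rightarrow> bool" where
  "morse_function A f \<longleftrightarrow>
     smooth_function A f \<and>
     (\<forall>x \<in> critical_points A f. \<forall>c\<in>A. x \<in> cdom c \<longrightarrow>
        (\<forall>u. (\<forall>w. hessian f c x u w = 0) \<longrightarrow> u = 0))"

definition morse_index ::
  "('a, 'e::{banach, heine_borel}) chart set \<Rightarrow> ('a \<Rightarrow> real) \<Rightarrow> 'a \<Rightarrow> nat" where
  "morse_index A f x =
     (let c = (SOME c. c \<in> A \<and> x \<in> cdom c)
      in Max {dim V | V. subspace V \<and> (\<forall>u\<in>V. u \<noteq> 0 \<longrightarrow> hessian f c x u u < 0)})"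

definition crit_between ::
  "('a, 'e::{banach, heine_borel}) chart set \<Rightarrow> ('a \<Rightarrow> real) \<Rightarrow> real \<Rightarrow> real \<Rightarrow> 'a set" where
  "crit_between A f a b = {x \<in> critical_points A f. a \<le> f x \<and> f x \<le> b}"


section \<open>Curves and flow lines\<close>

definition smooth_curves ::
  "('a::topological_space, 'e::{banach, heine_borel}) chart set \<Rightarrow> (real \<Rightarrow> 'a) set" where
  "smooth_curves A =
     {x. continuous_on UNIV x \<and> (\<forall>c\<in>A. smooth_on (cmap c \<circ> x) (x -` cdom c))}"

text \<open>The topology of \<open>C\<^sup>\<infinity>\<^sub>l\<^sub>o\<^sub>c\<close>-convergence on the set of smooth curves, that is, the weak Whitney
  topology: a subbasic neighbourhood of \<open>x\<close> prescribes, over a compact set \<open>Q\<close> of times at which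
  \<open>x\<close> lies in the domain of a chart \<open>c\<close>, closeness of the derivatives up to order \<open>r\<close> in the
  chart \<open>c\<close>. The case of empty \<open>Q\<close> makes the whole space a subbasic set.\<close>

definition curve_deriv ::
  "('a, 'e::real_normed_vector) chart \<Rightarrow> nat \<Rightarrow> (real \<Rightarrow> 'a) \<Rightarrow> real \<Rightarrow> 'e" where
  "curve_deriv c j x = ((\<lambda>h t. vector_derivative h (at t)) ^^ j) (cmap c \<circ> x)"

definition Cinf_nbhd ::
  "('a::topological_space, 'e::{banach, heine_borel}) chart set \<Rightarrow>
     (real \<Rightarrow> 'a) \<Rightarrow> ('a, 'e) chart \<Rightarrow> real set \<Rightarrow> nat \<Rightarrow> real \<Rightarrow> (real \<Rightarrow> 'a) set" where
  "Cinf_nbhd A x c Q r e =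
     {y \<in> smooth_curves A. y ` Q \<subseteq> cdom c \<and>
        (\<forall>j\<le>r. \<forall>s\<in>Q. norm (curve_deriv c j y s - curve_deriv c j x s) < e)}"

definition Cinf_loc_topology ::
  "('a::topological_space, 'e::{banach, heine_borel}) chart set \<Rightarrow> (real \<Rightarrow> 'a) topology" where
  "Cinf_loc_topology A =
     topology_generated_by
       {Cinf_nbhd A x c Q r e | x c Q r e.
          x \<in> smooth_curves A \<and> c \<in> A \<and> compact Q \<and> x ` Q \<subseteq> cdom c \<and> 0 < e}"

definition integral_curve ::
  "('a::topological_space, 'e::{banach, heine_borel}) chart set \<Rightarrow>
     ('a, 'e) vfield \<Rightarrow> (real \<Rightarrow> 'a) \<Rightarrow> bool" where
  "integral_curve A v x \<longleftrightarrow>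
     continuous_on UNIV x \<and>
     (\<forall>s. \<forall>c\<in>A. x s \<in> cdom c \<longrightarrow> ((cmap c \<circ> x) has_vector_derivative v c (x s)) (at s))"

definition grad_lines ::
  "('a::topological_space, 'e::{banach, heine_borel}) chart set \<Rightarrow> ('a, 'e) metric \<Rightarrow>
     ('a \<Rightarrow> real) \<Rightarrow> real \<Rightarrow> real \<Rightarrow> (real \<Rightarrow> 'a) set" where
  "grad_lines A g f a b =
     {x \<in> smooth_curves A.
        integral_curve A (\<lambda>c p. - gradient g f c p) x \<and> (\<forall>s. a \<le> f (x s) \<and> f (x s) \<le> b)}"

definition perturbed_lines ::
  "('a::topological_space, 'e::{banach, heine_borel}) chart set \<Rightarrow> ('a, 'e) metric \<Rightarrow>
     ('a \<Rightarrow> real) \<Rightarrow> real \<Rightarrow> real \<Rightarrow> ('a, 'e) vfield \<Rightarrow> 'a set \<Rightarrow> (real \<Rightarrow> 'a) set" where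
  "perturbed_lines A g f a b v M =
     {x. integral_curve A (\<lambda>c p. - gradient g f c p + v c p) x \<and>
         (\<forall>s. a \<le> f (x s) \<and> f (x s) \<le> b) \<and> (\<forall>s. x s \<in> M)}"

end

theory Submission
  imports Defs
begin

text \<open>The proof is a compactness argument. If no \<open>\<epsilon>\<close> works, then for every \<open>\<epsilon> > 0\<close> there is a
  curve \<open>y\<close> in the closure of \<open>N\<close> with \<open>a \<le> f \<le> b\<close> that solves the gradient equation up to a
  vector field of length less than \<open>\<epsilon>\<close> and, after a shift of time, satisfies \<open>y 0 \<notin> N\<close>. By
  Tychonoff's theorem these curves have a pointwise cluster point \<open>x\<close> as \<open>\<epsilon>\<close> tends to \<open>0\<close>, taken along a
  filter on the space of all functions from the reals to the manifold. It will be shown that \<open>x\<close> is a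
  gradient line between \<open>a\<close> and \<open>b\<close>. Then \<open>x 0 \<in> N\<close> by the choice of \<open>N\<close>, whereas \<open>x 0 \<notin> N\<close>
  because the complement of \<open>N\<close> is closed.

  That a merely pointwise limit solves the limit equation (\<open>near_integral_curves_limit\<close>) rests on a
  local estimate (\<open>uniform_chart_drift\<close>): in a chart around \<open>z\<close>, each of the
  curves satisfies \<open>\<parallel>y t - y s - (t - s) V z\<parallel> \<le> \<eta> \<bar>t - s\<bar>\<close>, with the same bound on
  \<open>\<bar>t - s\<bar>\<close> for all of them, once \<open>y s\<close> is near \<open>z\<close> and \<open>\<epsilon>\<close> is small. No velocity of \<open>y\<close>
  occurs in this inequality, so it passes to the limit and there expresses differentiability.

  It remains to see that \<open>x\<close> is smooth. The gradient is smooth in charts by a Riesz representation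
  with smooth dependence on the base point (\<open>smooth_Riesz_representation\<close>), and integral curves of
  smooth fields are smooth (\<open>smooth_on_integral_curve\<close>). The Riesz representation of the
  coordinate functionals also shows that the Riemannian length locally dominates the norm of the model space
  (\<open>norm_locally_dominated\<close>), which turns the bound on the perturbation into a bound in the
  chart.\<close>


section \<open>Calculus of the classes \<open>C\<^sup>k\<close>\<close>

lemma Ck_on_cong:
  assumes "open S" "\<And>p. p \<in> S \<Longrightarrow> h p = h' p" "Ck_on k h S"
  shows "Ck_on k h' S"
  using assms(2,3)
proof (induction k arbitrary: h h')
  case 0
  then show ?case using continuous_on_cong by force
next
  case (Suc k)
  have d: "(h has_derivative frechet_derivative h (at p)) (at p)" if "p \<in> S" for p
    using Suc.prems that by (auto simp: frechet_derivative_works)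
  have d': "(h' has_derivative frechet_derivative h (at p)) (at p)" if "p \<in> S" for p
    using has_derivative_transform_within_open[OF d[OF that] \<open>open S\<close> that] Suc.prems(1) by blast
  then have "frechet_derivative h (at p) = frechet_derivative h' (at p)" if "p \<in> S" for p
    using that frechet_derivative_at by blast
  then have "Ck_on k (\<lambda>p. frechet_derivative h' (at p) w) S" for w
    using Suc.IH[of "\<lambda>p. frechet_derivative h (at p) w"] Suc.prems(2) by auto
  then show ?case using d' by (auto simp: differentiable_def)
qed

lemma Ck_on_SucI:
  assumes "open S" "\<And>p. p \<in> S \<Longrightarrow> (h has_derivative D p) (at p)"
    and "\<And>w. Ck_on k (\<lambda>p. D p w) S"
  shows "Ck_on (Suc k) h S"
proof -
  have "Ck_on k (\<lambda>p. frechet_derivative h (at p) w) S" for w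
    by (rule Ck_on_cong[OF assms(1) _ assms(3)[of w]])
      (simp add: frechet_derivative_at[OF assms(2), symmetric])
  then show ?thesis using assms(2) by (auto simp: differentiable_def)
qed

lemma Ck_on_has_derivative:
  assumes "Ck_on (Suc k) h S" "p \<in> S"
  shows "(h has_derivative frechet_derivative h (at p)) (at p)"
  using assms by (auto simp: frechet_derivative_works)

lemma Ck_on_SucD: "Ck_on (Suc k) h S \<Longrightarrow> Ck_on k h S"
proof (induction k arbitrary: h)
  case 0
  then show ?case
    by (auto intro!: continuous_at_imp_continuous_on differentiable_imp_continuous_within)
qed auto

lemma Ck_on_const: "Ck_on k (\<lambda>p. c) S"
  by (induction k arbitrary: c) (auto simp: frechet_derivative_const)

lemma Ck_on_add:
  assumes "open S" "Ck_on k h S" "Ck_on k h' S"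
  shows "Ck_on k (\<lambda>p. h p + h' p) S"
  using assms(2,3)
proof (induction k arbitrary: h h')
  case 0
  then show ?case by (auto intro: continuous_intros)
next
  case (Suc k)
  show ?case
    by (rule Ck_on_SucI[OF assms(1) has_derivative_add[OF Ck_on_has_derivative[OF Suc.prems(1)]
            Ck_on_has_derivative[OF Suc.prems(2)]]]) (use Suc in auto)
qed

lemma Ck_on_scaleR:
  fixes \<alpha> :: "'p::real_normed_vector \<Rightarrow> real"
  assumes "open S" "Ck_on k \<alpha> S" "Ck_on k h S"
  shows "Ck_on k (\<lambda>p. \<alpha> p *\<^sub>R h p) S"
  using assms(2,3)
proof (induction k arbitrary: \<alpha> h)
  case 0
  then show ?case by (auto intro: continuous_intros)
next
  case (Suc k)
  note lower = Suc.prems[THEN Ck_on_SucD]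
  show ?case
    by (rule Ck_on_SucI[OF assms(1) has_derivative_scaleR[OF Ck_on_has_derivative[OF Suc.prems(1)]
            Ck_on_has_derivative[OF Suc.prems(2)]]])
      (use Suc lower in \<open>auto intro!: Ck_on_add assms(1)\<close>)
qed

lemma Ck_on_inverse:
  fixes \<alpha> :: "'p::real_normed_vector \<Rightarrow> real"
  assumes "open S" "Ck_on k \<alpha> S" "\<And>p. p \<in> S \<Longrightarrow> \<alpha> p \<noteq> 0"
  shows "Ck_on k (\<lambda>p. inverse (\<alpha> p)) S"
  using assms(2,3)
proof (induction k arbitrary: \<alpha>)
  case 0
  then show ?case by (auto intro: continuous_intros)
next
  case (Suc k)
  have inv: "Ck_on k (\<lambda>p. inverse (\<alpha> p)) S"
    using Suc.IH Suc.prems Ck_on_SucD by blast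
  show ?case
  proof (rule Ck_on_SucI[OF assms(1)])
    show "((\<lambda>p. inverse (\<alpha> p)) has_derivative
        (\<lambda>w. (- inverse (\<alpha> p)) *\<^sub>R (inverse (\<alpha> p) *\<^sub>R frechet_derivative \<alpha> (at p) w))) (at p)"
      if "p \<in> S" for p
      by (rule has_derivative_eq_rhs,
          rule Deriv.has_derivative_inverse[OF _ Ck_on_has_derivative[OF Suc.prems(1) that]])
        (use Suc.prems(2) that in \<open>auto simp: fun_eq_iff\<close>)
    have "Ck_on k (\<lambda>p. - inverse (\<alpha> p)) S"
      using Ck_on_scaleR[OF assms(1) Ck_on_const[of k "-1"] inv] by simp
    then show "Ck_on k (\<lambda>p. (- inverse (\<alpha> p)) *\<^sub>R (inverse (\<alpha> p) *\<^sub>R frechet_derivative \<alpha> (at p) w)) S" for w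
      using Suc.prems(1) by (intro Ck_on_scaleR assms(1) inv) auto
  qed
qed

lemma smooth_on_id: "open S \<Longrightarrow> smooth_on (\<lambda>p. p) S"
  unfolding smooth_on_def
proof
  fix k assume "open S"
  show "Ck_on k (\<lambda>p. p) S"
    using Ck_on_SucI[OF \<open>open S\<close> has_derivative_ident Ck_on_const] Ck_on_SucD by blast
qed

lemma smooth_on_const: "smooth_on (\<lambda>p. c) S"
  by (simp add: smooth_on_def Ck_on_const)

lemma smooth_on_cong:
  "open S \<Longrightarrow> (\<And>p. p \<in> S \<Longrightarrow> h p = h' p) \<Longrightarrow> smooth_on h S \<Longrightarrow> smooth_on h' S"
  unfolding smooth_on_def using Ck_on_cong by blast

lemma smooth_on_scaleR:
  "open S \<Longrightarrow> smooth_on \<alpha> S \<Longrightarrow> smooth_on h S \<Longrightarrow> smooth_on (\<lambda>p. \<alpha> p *\<^sub>R h p) S"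
  by (simp add: smooth_on_def Ck_on_scaleR)

lemma smooth_on_inverse:
  fixes \<alpha> :: "'p::real_normed_vector \<Rightarrow> real"
  shows "open S \<Longrightarrow> smooth_on \<alpha> S \<Longrightarrow> (\<And>p. p \<in> S \<Longrightarrow> \<alpha> p \<noteq> 0) \<Longrightarrow>
    smooth_on (\<lambda>p. inverse (\<alpha> p)) S"
  by (simp add: smooth_on_def Ck_on_inverse)

lemma smooth_on_add:
  "open S \<Longrightarrow> smooth_on h S \<Longrightarrow> smooth_on h' S \<Longrightarrow> smooth_on (\<lambda>p. h p + h' p) S"
  by (simp add: smooth_on_def Ck_on_add)

lemma smooth_on_sum:
  "open S \<Longrightarrow> (\<And>i. i \<in> I \<Longrightarrow> smooth_on (h i) S) \<Longrightarrow> smooth_on (\<lambda>p. \<Sum>i\<in>I. h i p) S"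
  by (induction I rule: infinite_finite_induct) (auto intro: smooth_on_add smooth_on_const)

lemma smooth_on_imp_continuous_on: "smooth_on h S \<Longrightarrow> continuous_on S h"
  by (metis Ck_on.simps(1) smooth_on_def)

lemma smooth_on_has_derivative:
  "smooth_on h S \<Longrightarrow> p \<in> S \<Longrightarrow> (h has_derivative frechet_derivative h (at p)) (at p)"
  unfolding smooth_on_def using Ck_on_has_derivative by blast

lemma smooth_on_frechet_derivative:
  "smooth_on h S \<Longrightarrow> smooth_on (\<lambda>p. frechet_derivative h (at p) w) S"
  unfolding smooth_on_def by (metis Ck_on.simps(2))


section \<open>Smooth Riesz representation\<close>

text \<open>Vector fields are handled through coefficient functions with respect to a fixed basis. This
  turns the evaluation of a linear map on such a field into a finite sum of products, so that it is
  enough to control the dependence of the linear map on the base point one basis vector at a time.\<close>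

definition smooth_combination :: "'e::real_normed_vector set \<Rightarrow> 'p::real_normed_vector set \<Rightarrow> ('p \<Rightarrow> 'e) \<Rightarrow> bool"
  where "smooth_combination B S V \<longleftrightarrow>
    (\<exists>\<alpha>. (\<forall>b. smooth_on (\<alpha> b) S) \<and> (\<forall>p\<in>S. V p = (\<Sum>b\<in>B. \<alpha> b p *\<^sub>R b)))"

lemma smooth_combination_in_span: "smooth_combination B S V \<Longrightarrow> p \<in> S \<Longrightarrow> V p \<in> span B"
  unfolding smooth_combination_def by (auto intro!: span_sum simp: span_scale span_base)

lemma smooth_combination_imp_smooth_on:
  assumes "open S" "smooth_combination B S V"
  shows "smooth_on V S"
proof -
  obtain \<alpha> where \<alpha>: "\<And>b. smooth_on (\<alpha> b) S" and V: "\<And>p. p \<in> S \<Longrightarrow> V p = (\<Sum>b\<in>B. \<alpha> b p *\<^sub>R b)"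
    using assms(2) unfolding smooth_combination_def by blast
  have "smooth_on (\<lambda>p. \<Sum>b\<in>B. \<alpha> b p *\<^sub>R b) S"
    using \<alpha> by (intro smooth_on_sum smooth_on_scaleR smooth_on_const assms)
  then show ?thesis using V by (auto intro: smooth_on_cong[OF assms(1)])
qed

lemma smooth_combination_cong:
  assumes "\<And>p. p \<in> S \<Longrightarrow> W p = V p" "smooth_combination B S V"
  shows "smooth_combination B S W"
proof -
  obtain \<alpha> where \<alpha>: "\<And>b. smooth_on (\<alpha> b) S" "\<And>p. p \<in> S \<Longrightarrow> V p = (\<Sum>b\<in>B. \<alpha> b p *\<^sub>R b)"
    using assms(2) unfolding smooth_combination_def by blast
  then show ?thesis
    unfolding smooth_combination_def by (intro exI[of _ \<alpha>]) (simp add: assms(1))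
qed

lemma smooth_on_linear_combination:
  assumes "open S" "smooth_combination B S V"
    and "\<And>p. p \<in> S \<Longrightarrow> linear (L p)" "\<And>u. smooth_on (\<lambda>p. L p u) S"
  shows "smooth_on (\<lambda>p. L p (V p)) S"
proof -
  obtain \<alpha> where \<alpha>: "\<And>b. smooth_on (\<alpha> b) S" and V: "\<And>p. p \<in> S \<Longrightarrow> V p = (\<Sum>b\<in>B. \<alpha> b p *\<^sub>R b)"
    using assms(2) unfolding smooth_combination_def by blast
  have "smooth_on (\<lambda>p. \<Sum>b\<in>B. \<alpha> b p *\<^sub>R L p b) S"
    using \<alpha> assms(4) by (intro smooth_on_sum smooth_on_scaleR assms(1))
  then show ?thesis
    by (rule smooth_on_cong[OF assms(1), rotated])
      (simp add: V linear_sum[OF assms(3)] linear_scale[OF assms(3)])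
qed

lemma smooth_combination_insert:
  assumes "open S" "finite B" "b \<notin> B" "smooth_combination B S V" "smooth_combination B S W" "smooth_on \<beta> S"
  shows "smooth_combination (insert b B) S (\<lambda>p. V p + \<beta> p *\<^sub>R (b - W p))"
proof -
  obtain \<alpha> where \<alpha>: "\<And>b. smooth_on (\<alpha> b) S" "\<And>p. p \<in> S \<Longrightarrow> V p = (\<Sum>b\<in>B. \<alpha> b p *\<^sub>R b)"
    using assms(4) unfolding smooth_combination_def by blast
  obtain \<omega> where \<omega>: "\<And>b. smooth_on (\<omega> b) S" "\<And>p. p \<in> S \<Longrightarrow> W p = (\<Sum>b\<in>B. \<omega> b p *\<^sub>R b)"
    using assms(5) unfolding smooth_combination_def by blast
  \<comment> \<open>The coefficients of the combination: the new basis vector occurs only through \<open>\<beta>\<close>.\<close>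
  define \<gamma> where "\<gamma> i p = (if i = b then \<beta> p else \<alpha> i p + (- 1) *\<^sub>R (\<beta> p *\<^sub>R \<omega> i p))" for i p
  have "smooth_on (\<gamma> i) S" for i
  proof (cases "i = b")
    case False
    then have "\<gamma> i = (\<lambda>p. \<alpha> i p + (- 1) *\<^sub>R (\<beta> p *\<^sub>R \<omega> i p))" by (auto simp: \<gamma>_def)
    moreover have "smooth_on (\<lambda>p. \<alpha> i p + (- 1) *\<^sub>R (\<beta> p *\<^sub>R \<omega> i p)) S"
      by (intro smooth_on_add smooth_on_scaleR smooth_on_const assms \<alpha> \<omega>)
    ultimately show ?thesis by simp
  next
    case True
    then have "\<gamma> i = \<beta>" by (auto simp: \<gamma>_def)
    then show ?thesis using assms(6) by simp
  qed
  moreover have "V p + \<beta> p *\<^sub>R (b - W p) = (\<Sum>i\<in>insert b B. \<gamma> i p *\<^sub>R i)" if "p \<in> S" for p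
  proof -
    have "(\<Sum>i\<in>B. \<gamma> i p *\<^sub>R i) = (\<Sum>i\<in>B. (\<alpha> i p - \<beta> p * \<omega> i p) *\<^sub>R i)"
      by (intro sum.cong) (use assms(3) in \<open>auto simp: \<gamma>_def\<close>)
    also have "\<dots> = V p - \<beta> p *\<^sub>R W p"
      using that by (simp add: \<alpha> \<omega> scaleR_left_diff_distrib sum_subtractf scaleR_sum_right)
    finally show ?thesis using assms(2,3) by (simp add: \<gamma>_def algebra_simps)
  qed
  ultimately show ?thesis unfolding smooth_combination_def by blast
qed

text \<open>The representing vector on the span of \<open>insert b B\<close> is the one on the span of \<open>B\<close> corrected
  along \<open>b - z\<close>, where \<open>z\<close> is the orthogonal projection of \<open>b\<close>. The projection is itself the
  representing vector of \<open>\<gamma> b\<close>, so the induction hypothesis also provides it as a smooth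
  field. Only division by the positive function \<open>\<gamma> (b - z) (b - z)\<close> occurs, hence smoothness is
  preserved.\<close>

lemma smooth_Riesz_representation:
  fixes \<gamma> :: "'p::real_normed_vector \<Rightarrow> 'e::real_normed_vector \<Rightarrow> 'e \<Rightarrow> real"
  assumes "open S" "finite B" "independent B"
    and bil: "\<And>p. p \<in> S \<Longrightarrow> bilinear (\<gamma> p)"
    and sym: "\<And>p u w. p \<in> S \<Longrightarrow> \<gamma> p u w = \<gamma> p w u"
    and pos: "\<And>p u. p \<in> S \<Longrightarrow> u \<noteq> 0 \<Longrightarrow> \<gamma> p u u > 0"
    and smooth: "\<And>u w. smooth_on (\<lambda>p. \<gamma> p u w) S"
    and lin: "\<And>p. p \<in> S \<Longrightarrow> linear (l p)" "\<And>u. smooth_on (\<lambda>p. l p u) S"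
  shows "\<exists>V. smooth_combination B S V \<and> (\<forall>p\<in>S. \<forall>u\<in>span B. \<gamma> p (V p) u = l p u)"
  using assms(2,3) lin
proof (induction B arbitrary: l rule: finite_induct)
  case empty
  have "l p 0 = 0" if "p \<in> S" for p using empty(2)[OF that] linear_0 by blast
  moreover have "\<gamma> p 0 0 = 0" if "p \<in> S" for p using bil[OF that] bilinear_lzero by blast
  ultimately show ?case
    by (intro exI[of _ "\<lambda>p. 0"]) (auto simp: smooth_combination_def intro: smooth_on_const)
next
  case (insert b B)
  have ind: "independent B" "b \<notin> span B"
    using insert.prems(1) insert.hyps by (auto simp: independent_insert)
  have lin\<gamma>: "linear (\<gamma> p u)" "linear (\<lambda>w. \<gamma> p w u)" if "p \<in> S" for p u
    using bil[OF that] by (auto simp: bilinear_def)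
  obtain V where V: "smooth_combination B S V" "\<And>p u. p \<in> S \<Longrightarrow> u \<in> span B \<Longrightarrow> \<gamma> p (V p) u = l p u"
    using insert.IH[OF ind(1) insert.prems(2,3)] by blast
  obtain Z where Z: "smooth_combination B S Z" "\<And>p u. p \<in> S \<Longrightarrow> u \<in> span B \<Longrightarrow> \<gamma> p (Z p) u = \<gamma> p b u"
    using insert.IH[OF ind(1), of "\<lambda>p. \<gamma> p b"] lin\<gamma> smooth by blast
  define n where "n p = b - Z p" for p
  have nz: "n p \<noteq> 0" if "p \<in> S" for p
    using smooth_combination_in_span[OF Z(1) that] ind by (auto simp: n_def)
  have orth: "\<gamma> p (n p) u = 0" if "p \<in> S" "u \<in> span B" for p u
    using Z(2)[OF that] by (simp add: n_def bilinear_lsub[OF bil[OF that(1)]])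
  have "smooth_combination (insert b B) S (\<lambda>p. 0 + 1 *\<^sub>R (b - Z p))"
    by (intro smooth_combination_insert assms insert.hyps Z smooth_on_const)
      (auto simp: smooth_combination_def intro: exI[of _ "\<lambda>_ _. 0"] smooth_on_const)
  then have n: "smooth_combination (insert b B) S n" by (simp add: n_def[abs_def])
  define \<beta> where "\<beta> p = l p (n p) *\<^sub>R inverse (\<gamma> p (n p) (n p))" for p
  have "smooth_on (\<lambda>p. \<gamma> p u (n p)) S" for u
    by (rule smooth_on_linear_combination[OF assms(1) n]) (use lin\<gamma> smooth in auto)
  then have "smooth_on (\<lambda>p. \<gamma> p (n p) (n p)) S"
    by (intro smooth_on_linear_combination[OF assms(1) n, where L = "\<lambda>p w. \<gamma> p w (n p)"])
       (use lin\<gamma> in auto)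
  then have "smooth_on (\<lambda>p. inverse (\<gamma> p (n p) (n p))) S"
    by (rule smooth_on_inverse[OF assms(1)]) (metis pos nz less_irrefl)
  moreover have "smooth_on (\<lambda>p. l p (n p)) S"
    by (rule smooth_on_linear_combination[OF assms(1) n]) (use insert.prems in auto)
  ultimately have \<beta>: "smooth_on \<beta> S"
    unfolding \<beta>_def by (intro smooth_on_scaleR assms)
  define W where "W p = V p + \<beta> p *\<^sub>R n p" for p
  have "smooth_combination (insert b B) S W"
    unfolding W_def n_def by (intro smooth_combination_insert assms insert.hyps V Z \<beta>)
  moreover have "\<gamma> p (W p) u = l p u" if p: "p \<in> S" and uB: "u \<in> span (insert b B)" for p u
  proof -
    obtain r where "u - r *\<^sub>R b \<in> span B" using uB by (auto simp: span_insert)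
    then have "u - r *\<^sub>R n p \<in> span B" (is "?u \<in> _")
      using smooth_combination_in_span[OF Z(1) p]
        span_add[of "u - r *\<^sub>R b" B "r *\<^sub>R Z p"] by (auto simp: n_def algebra_simps span_scale)
    note u = this
    have split: "u = ?u + r *\<^sub>R n p" by simp
    have "\<gamma> p (W p) ?u = l p ?u"
      using V(2)[OF p u] orth[OF p u] bil[OF p]
      by (simp add: W_def bilinear_ladd bilinear_lmul)
    moreover have "\<gamma> p (V p) (n p) = 0"
      using orth[OF p smooth_combination_in_span[OF V(1) p]] sym p by simp
    then have "\<gamma> p (W p) (n p) = l p (n p)"
      using pos[OF p nz[OF p]] bil[OF p]
      by (simp add: W_def bilinear_ladd bilinear_lmul \<beta>_def)
    moreover have "\<gamma> p (W p) u = \<gamma> p (W p) ?u + r * \<gamma> p (W p) (n p)"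
      by (subst split, simp only: bilinear_radd[OF bil[OF p]] bilinear_rmul[OF bil[OF p]]) simp
    moreover have "l p u = l p ?u + r * l p (n p)"
      by (subst split, simp only: linear_add[OF insert.prems(2)[OF p]]
            linear_scale[OF insert.prems(2)[OF p]]) simp
    ultimately show ?thesis by simp
  qed
  ultimately show ?case by blast
qed

text \<open>Each coordinate functional is represented by a smooth field of vectors, and the
  Cauchy-Schwarz inequality bounds the coordinates of \<open>u\<close> by the length of \<open>u\<close> times the
  continuous length of that field.\<close>

lemma norm_locally_dominated:
  fixes \<gamma> :: "'p::real_normed_vector \<Rightarrow> 'e::real_normed_vector \<Rightarrow> 'e \<Rightarrow> real"
    and B :: "'e set"
  assumes "open S" "finite B" "independent B" "span B = UNIV"
    and bil: "\<And>p. p \<in> S \<Longrightarrow> bilinear (\<gamma> p)"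
    and sym: "\<And>p u w. p \<in> S \<Longrightarrow> \<gamma> p u w = \<gamma> p w u"
    and pos: "\<And>p u. p \<in> S \<Longrightarrow> u \<noteq> 0 \<Longrightarrow> \<gamma> p u u > 0"
    and smooth: "\<And>u w. smooth_on (\<lambda>p. \<gamma> p u w) S"
    and "q \<in> S"
  shows "\<exists>K>0. \<forall>\<^sub>F p in nhds q. \<forall>u. norm u \<le> K * sqrt (\<gamma> p u u)"
proof -
  have lin\<gamma>: "linear (\<gamma> p u)" "linear (\<lambda>w. \<gamma> p w u)" if "p \<in> S" for p u
    using bil[OF that] by (auto simp: bilinear_def)
  have nonneg: "\<gamma> p u u \<ge> 0" if "p \<in> S" for p u
    using pos[OF that, of u] bilinear_lzero[OF bil[OF that]] by (cases "u = 0") auto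
  have "\<exists>V. smooth_combination B S V \<and> (\<forall>p\<in>S. \<forall>u\<in>span B. \<gamma> p (V p) u = representation B u b)" for b
    by (rule smooth_Riesz_representation[OF assms(1-3) bil sym pos smooth])
      (auto intro!: linearI smooth_on_const simp: assms representation_add representation_scale)
  then obtain V where V: "\<And>b. smooth_combination B S (V b)"
    "\<And>b p u. p \<in> S \<Longrightarrow> \<gamma> p (V b p) u = representation B u b"
    using \<open>span B = UNIV\<close> by (metis UNIV_I)
  define K where "K p = (\<Sum>b\<in>B. sqrt (\<gamma> p (V b p) (V b p)) * norm b)" for p
  have dom: "norm u \<le> K p * sqrt (\<gamma> p u u)" if "p \<in> S" for p u
  proof -
    have CS: "\<bar>\<gamma> p v u\<bar> \<le> sqrt (\<gamma> p v v) * sqrt (\<gamma> p u u)" for v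
    proof (cases "v = 0")
      case True
      then show ?thesis using bilinear_lzero[OF bil[OF that]] by auto
    next
      case False
      \<comment> \<open>The multiple of \<open>v\<close> closest to \<open>u\<close> gives the Cauchy-Schwarz inequality.\<close>
      define r where "r = \<gamma> p v u / \<gamma> p v v"
      have vv: "\<gamma> p v v > 0" using pos[OF that False] .
      have "0 \<le> \<gamma> p (u - r *\<^sub>R v) (u - r *\<^sub>R v)" using nonneg[OF that] .
      also have "\<dots> = \<gamma> p u u - 2 * r * \<gamma> p v u + r * r * \<gamma> p v v"
        using bil[OF that] sym[OF that, of u v]
        by (simp add: bilinear_lsub bilinear_rsub bilinear_lmul bilinear_rmul algebra_simps)
      also have "\<dots> = \<gamma> p u u - (\<gamma> p v u)\<^sup>2 / \<gamma> p v v"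
        using vv by (simp add: r_def power2_eq_square field_simps)
      finally have "(\<gamma> p v u)\<^sup>2 \<le> \<gamma> p v v * \<gamma> p u u"
        using vv by (simp add: field_simps)
      then show ?thesis
        using real_sqrt_le_mono by (fastforce simp: real_sqrt_mult[symmetric])
    qed
    have "norm u = norm (\<Sum>b\<in>B. representation B u b *\<^sub>R b)"
      using sum_representation_eq[OF assms(3) _ assms(2)] assms(4) by simp
    also have "\<dots> \<le> (\<Sum>b\<in>B. \<bar>\<gamma> p (V b p) u\<bar> * norm b)"
      by (intro sum_norm_le) (simp add: V(2)[OF that])
    also have "\<dots> \<le> (\<Sum>b\<in>B. (sqrt (\<gamma> p (V b p) (V b p)) * sqrt (\<gamma> p u u)) * norm b)"
      by (intro sum_mono mult_right_mono CS) simp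
    finally show ?thesis by (simp add: K_def sum_distrib_left sum_distrib_right mult_ac)
  qed
  have "smooth_on (\<lambda>p. \<gamma> p u (V b p)) S" for b u
    by (rule smooth_on_linear_combination[OF assms(1) V(1)]) (use lin\<gamma> smooth in auto)
  then have "smooth_on (\<lambda>p. \<gamma> p (V b p) (V b p)) S" for b
    by (intro smooth_on_linear_combination[OF assms(1) V(1), where L = "\<lambda>p w. \<gamma> p w (V b p)"])
       (use lin\<gamma> in auto)
  then have "continuous_on S K"
    unfolding K_def by (intro continuous_intros smooth_on_imp_continuous_on)
  then have "(K \<longlongrightarrow> K q) (nhds q)"
    using \<open>q \<in> S\<close> \<open>open S\<close> by (simp add: continuous_on_eq_continuous_at continuous_at tendsto_at_iff_tendsto_nhds)
  then have "\<forall>\<^sub>F p in nhds q. K p < K q + 1"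
    by (rule order_tendstoD) simp
  moreover have "\<forall>\<^sub>F p in nhds q. p \<in> S"
    using \<open>q \<in> S\<close> \<open>open S\<close> by (rule eventually_nhds_in_open[rotated])
  ultimately have "\<forall>\<^sub>F p in nhds q. \<forall>u. norm u \<le> (K q + 1) * sqrt (\<gamma> p u u)"
  proof eventually_elim
    case (elim p)
    show ?case
    proof
      fix u
      have "K p * sqrt (\<gamma> p u u) \<le> (K q + 1) * sqrt (\<gamma> p u u)"
        using elim nonneg by (intro mult_right_mono) auto
      then show "norm u \<le> (K q + 1) * sqrt (\<gamma> p u u)" using dom[OF elim(2), of u] by linarith
    qed
  qed
  moreover have "K q \<ge> 0" unfolding K_def using nonneg[OF \<open>q \<in> S\<close>] by (intro sum_nonneg) auto
  ultimately show ?thesis by (intro exI[of _ "K q + 1"]) auto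
qed


section \<open>Smoothness of integral curves\<close>

text \<open>Along an integral curve \<open>h\<close> of \<open>F\<close>, differentiating \<open>\<Phi> \<circ> h\<close> gives
  \<open>(L \<Phi>) \<circ> h\<close> with the Lie derivative \<open>L \<Phi> p = D\<Phi>(p)(F p)\<close>, which is again smooth. Letting
  \<open>\<Phi>\<close> vary in the induction therefore avoids a chain rule for higher derivatives.\<close>

lemma smooth_on_integral_curve:
  fixes h :: "real \<Rightarrow> 'e::real_normed_vector" and \<Phi> :: "'e \<Rightarrow> 'q::real_normed_vector"
  assumes "open S" "open T" "h ` T \<subseteq> S" "smooth_combination B S F"
    and h: "\<And>s. s \<in> T \<Longrightarrow> (h has_vector_derivative F (h s)) (at s)"
    and "smooth_on \<Phi> S"
  shows "smooth_on (\<lambda>s. \<Phi> (h s)) T"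
  unfolding smooth_on_def
proof
  fix k
  show "Ck_on k (\<lambda>s. \<Phi> (h s)) T"
    using \<open>smooth_on \<Phi> S\<close>
  proof (induction k arbitrary: \<Phi>)
    case 0
    have "continuous_on T h"
      using h has_vector_derivative_continuous continuous_at_imp_continuous_on by blast
    then show ?case
      using continuous_on_compose2[OF smooth_on_imp_continuous_on[OF 0]] assms(3) by auto
  next
    case (Suc k)
    let ?L = "\<lambda>p. frechet_derivative \<Phi> (at p) (F p)"
    have "smooth_on ?L S"
      by (rule smooth_on_linear_combination[OF assms(1,4)])
        (rule has_derivative_linear[OF smooth_on_has_derivative[OF Suc.prems]]
          smooth_on_frechet_derivative[OF Suc.prems] | assumption)+
    then have "Ck_on k (\<lambda>s. ?L (h s)) T" by (rule Suc.IH)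
    then have "Ck_on k (\<lambda>s. w *\<^sub>R ?L (h s)) T" for w
      by (intro Ck_on_scaleR Ck_on_const assms)
    moreover have "((\<lambda>s. \<Phi> (h s)) has_derivative (\<lambda>w. w *\<^sub>R ?L (h s))) (at s)" if "s \<in> T" for s
    proof -
      have D: "(\<Phi> has_derivative frechet_derivative \<Phi> (at (h s))) (at (h s))"
        using smooth_on_has_derivative[OF Suc.prems] assms(3) that by blast
      show ?thesis
        using has_derivative_compose[OF h[OF that, unfolded has_vector_derivative_def] D]
        by (simp add: linear_scale[OF has_derivative_linear[OF D]])
    qed
    ultimately show ?case by (intro Ck_on_SucI[OF assms(2)])
  qed
qed


section \<open>Curves with nearly constant velocity in a chart\<close>

lemma is_chart_cinv:
  assumes "is_chart c"
  shows "z \<in> cdom c \<Longrightarrow> cinv c (cmap c z) = z"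
    and "p \<in> cmap c ` cdom c \<Longrightarrow> cinv c p \<in> cdom c"
    and "p \<in> cmap c ` cdom c \<Longrightarrow> cmap c (cinv c p) = p"
  using assms unfolding is_chart_def homeomorphism_def by (auto simp: f_inv_into_f inv_into_into)

lemma is_chart_continuous_on: "is_chart c \<Longrightarrow> continuous_on (cdom c) (cmap c)"
  unfolding is_chart_def homeomorphism_def by auto

lemma is_chart_open_preimage:
  assumes "is_chart c" "open B"
  shows "open {z \<in> cdom c. cmap c z \<in> B}"
proof -
  have "open (cdom c \<inter> cmap c -` B)"
    using assms is_chart_continuous_on continuous_open_preimage unfolding is_chart_def by blast
  then show ?thesis by (simp add: vimage_def Collect_conj_eq)
qed

lemma is_chart_closed_preimage_cball:
  fixes c :: "('a::t2_space, 'e::{banach, heine_borel}) chart"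
  assumes "is_chart c" "cball q r \<subseteq> cmap c ` cdom c"
  shows "closed {z \<in> cdom c. cmap c z \<in> cball q r}"
proof -
  have "continuous_on (cball q r) (cinv c)"
    by (rule continuous_on_subset[OF _ assms(2)])
      (use assms(1) in \<open>simp add: is_chart_def homeomorphism_def\<close>)
  then have "closed (cinv c ` cball q r)"
    by (intro compact_imp_closed compact_continuous_image) auto
  moreover have "cinv c ` cball q r = {z \<in> cdom c. cmap c z \<in> cball q r}"
  proof
    show "cinv c ` cball q r \<subseteq> {z \<in> cdom c. cmap c z \<in> cball q r}"
    proof clarify
      fix p assume p: "p \<in> cball q r"
      then have "p \<in> cmap c ` cdom c" using assms(2) by (rule subsetD[rotated])
      from is_chart_cinv(2,3)[OF assms(1) this] p
      show "cinv c p \<in> cdom c \<and> cmap c (cinv c p) \<in> cball q r" by simp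
    qed
    show "{z \<in> cdom c. cmap c z \<in> cball q r} \<subseteq> cinv c ` cball q r"
    proof clarify
      fix z assume "z \<in> cdom c" "cmap c z \<in> cball q r"
      then show "z \<in> cinv c ` cball q r"
        using is_chart_cinv(1)[OF assms(1)] by (intro image_eqI[of _ _ "cmap c z"]) auto
    qed
  qed
  ultimately show ?thesis by simp
qed

text \<open>The curve cannot leave the chart before it leaves the ball: the part of the chart over a closed
  ball is closed in the manifold, so at a first exit time from the open ball the curve is still
  inside the chart, where the bound on the velocity shows that the distance covered is too small.\<close>

lemma chart_drift_forward:
  fixes c :: "('a::t2_space, 'e::{banach, heine_borel}) chart"
  assumes c: "is_chart c" and y: "continuous_on UNIV y" "y s \<in> cdom c"
    and ball: "cball (cmap c (y s)) r \<subseteq> cmap c ` cdom c" "r > 0"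
    and D: "\<And>t. y t \<in> cdom c \<Longrightarrow> cmap c (y t) \<in> cball (cmap c (y s)) r \<Longrightarrow>
        \<exists>d. ((cmap c \<circ> y) has_vector_derivative d) (at t) \<and> norm (d - w) \<le> \<eta>"
    and short: "(norm w + \<eta>) * \<tau> < r" "\<eta> \<ge> 0"
    and t: "s \<le> t" "t \<le> s + \<tau>"
  shows "y t \<in> cdom c \<and> cmap c (y t) \<in> cball (cmap c (y s)) r \<and>
    norm (cmap c (y t) - cmap c (y s) - (t - s) *\<^sub>R w) \<le> \<eta> * (t - s)"
proof -
  define h where "h = cmap c \<circ> y"
  define O' where "O' = {z \<in> cdom c. cmap c z \<in> ball (h s) r}"
  define C where "C = {z \<in> cdom c. cmap c z \<in> cball (h s) r}"
  have "open O'" unfolding O'_def using c by (intro is_chart_open_preimage) auto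
  have "closed C" unfolding C_def h_def using is_chart_closed_preimage_cball[OF c ball(1)] by simp
  have est: "norm (h t' - h s - (t' - s) *\<^sub>R w) \<le> \<eta> * (t' - s)"
    if "s \<le> t'" and inC: "\<And>r'. s \<le> r' \<Longrightarrow> r' \<le> t' \<Longrightarrow> y r' \<in> C" for t'
  proof (cases "s = t'")
    case False
    have "\<exists>d. (h has_vector_derivative d) (at r') \<and> norm (d - w) \<le> \<eta>" if "s \<le> r'" "r' \<le> t'" for r'
      using inC[OF that] D[of r'] by (auto simp: C_def h_def)
    then have "\<forall>r'\<in>{s..t'}. \<exists>d. (h has_vector_derivative d) (at r') \<and> norm (d - w) \<le> \<eta>"
      by simp
    then obtain d where "\<forall>r'\<in>{s..t'}. (h has_vector_derivative d r') (at r') \<and> norm (d r' - w) \<le> \<eta>"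
      by (rule bchoice[THEN exE])
    then have d: "(h has_vector_derivative d r') (at r')" "norm (d r' - w) \<le> \<eta>"
      if "s \<le> r'" "r' \<le> t'" for r'
      using that by auto
    have D': "((\<lambda>r. h r - r *\<^sub>R w) has_vector_derivative (d r' - w)) (at r')"
      if "s \<le> r'" "r' \<le> t'" for r'
      by (auto intro!: derivative_eq_intros d(1)[OF that] simp: that)
    have "norm ((h t' - t' *\<^sub>R w) - (h s - s *\<^sub>R w)) \<le> \<eta> * t' - \<eta> * s"
    proof (rule differentiable_bound_general[where f' = "\<lambda>r. d r - w"])
      show "continuous_on {s..t'} (\<lambda>r. h r - r *\<^sub>R w)"
        using has_vector_derivative_continuous[OF D']
        by (intro continuous_at_imp_continuous_on) auto
      show "((\<lambda>r. \<eta> * r) has_vector_derivative \<eta>) (at r')" for r'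
        by (auto intro!: derivative_eq_intros simp flip: has_real_derivative_iff_has_vector_derivative)
    qed (use False \<open>s \<le> t'\<close> D' d in \<open>auto intro!: continuous_intros\<close>)
    then show ?thesis by (simp add: algebra_simps)
  qed auto
  have inO: "y t' \<in> O'" if "s \<le> t'" "t' \<le> t" for t'
  proof (rule ccontr)
    assume "y t' \<notin> O'"
    \<comment> \<open>The infimum of \<open>E\<close> is the first exit time from the open ball.\<close>
    define E where "E = {s..t'} \<inter> y -` (- O')"
    have "closed E"
      unfolding E_def using \<open>open O'\<close> y(1)
      by (intro closed_Int closed_vimage) (auto simp: continuous_on_eq_continuous_at)
    moreover have "E \<noteq> {}" "bdd_below E" using that \<open>y t' \<notin> O'\<close> by (auto simp: E_def)
    ultimately have e: "Inf E \<in> E" using closed_contains_Inf by blast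
    define e where "e = Inf E"
    have before: "y r' \<in> O'" if "s \<le> r'" "r' < e" for r'
      using cInf_lower[OF _ \<open>bdd_below E\<close>, of r'] that e by (auto simp: E_def e_def)
    have "y s \<in> O'" using y(2) ball(2) by (auto simp: O'_def h_def)
    then have "s < e" using e by (auto simp: E_def e_def less_le)
    have "e \<in> closure {s<..<e}" using \<open>s < e\<close> by simp
    then have "y e \<in> closure (y ` {s<..<e})"
      using continuous_image_closure_subset[of UNIV y "{s<..<e}"] y(1) by auto
    also have "\<dots> \<subseteq> C"
      using before \<open>closed C\<close> by (intro closure_minimal) (auto simp: O'_def C_def less_imp_le)
    finally have "y e \<in> C" .
    then have "y r' \<in> C" if "s \<le> r'" "r' \<le> e" for r'
      using before[of r'] that by (cases "r' = e") (auto simp: O'_def C_def less_imp_le)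
    from est[OF less_imp_le[OF \<open>s < e\<close>] this]
    have "norm (h e - h s - (e - s) *\<^sub>R w) \<le> \<eta> * (e - s)" by simp
    moreover have "norm (h e - h s) \<le> norm (h e - h s - (e - s) *\<^sub>R w) + norm ((e - s) *\<^sub>R w)"
      using norm_triangle_ineq[of "h e - h s - (e - s) *\<^sub>R w" "(e - s) *\<^sub>R w"] by simp
    moreover have "norm ((e - s) *\<^sub>R w) = norm w * (e - s)" using \<open>s < e\<close> by simp
    ultimately have "norm (h e - h s) \<le> (norm w + \<eta>) * (e - s)"
      unfolding distrib_right by linarith
    also have "\<dots> \<le> (norm w + \<eta>) * \<tau>"
      using e that t short(2) by (intro mult_left_mono) (auto simp: E_def e_def)
    finally have "y e \<in> O'"
      using short(1) \<open>y e \<in> C\<close> by (auto simp: O'_def C_def h_def dist_norm norm_minus_commute)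
    then show False using e by (auto simp: E_def e_def)
  qed
  have "O' \<subseteq> C" by (auto simp: O'_def C_def)
  then have inC: "y r' \<in> C" if "s \<le> r'" "r' \<le> t" for r'
    using inO[OF that] by (rule subsetD)
  from est[OF t(1) inC] inC[OF t(1) order_refl] show ?thesis by (auto simp: C_def h_def)
qed

lemma chart_drift:
  fixes c :: "('a::t2_space, 'e::{banach, heine_borel}) chart"
  assumes c: "is_chart c" and y: "continuous_on UNIV y" "y s \<in> cdom c"
    and ball: "cball (cmap c (y s)) r \<subseteq> cmap c ` cdom c" "r > 0"
    and D: "\<And>t. y t \<in> cdom c \<Longrightarrow> cmap c (y t) \<in> cball (cmap c (y s)) r \<Longrightarrow>
        \<exists>d. ((cmap c \<circ> y) has_vector_derivative d) (at t) \<and> norm (d - w) \<le> \<eta>"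
    and short: "(norm w + \<eta>) * \<tau> < r" "\<eta> \<ge> 0"
    and t: "\<bar>t - s\<bar> \<le> \<tau>"
  shows "y t \<in> cdom c \<and> cmap c (y t) \<in> cball (cmap c (y s)) r \<and>
    norm (cmap c (y t) - cmap c (y s) - (t - s) *\<^sub>R w) \<le> \<eta> * \<bar>t - s\<bar>"
proof (cases "s \<le> t")
  case True
  then show ?thesis using chart_drift_forward[OF assms(1-8), of t] t by auto
next
  case False
  \<comment> \<open>Reversing time reduces this case to the forward estimate for the velocity \<open>- w\<close>.\<close>
  define z where "z = y \<circ> uminus"
  have z: "z (- s) = y s" "z (- t) = y t" by (auto simp: z_def)
  have "continuous_on UNIV z"
    unfolding z_def by (intro continuous_on_compose continuous_intros) (auto intro: continuous_on_subset y)
  moreover have "\<exists>d. ((cmap c \<circ> z) has_vector_derivative d) (at r') \<and> norm (d - (- w)) \<le> \<eta>"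
    if r': "z r' \<in> cdom c" "cmap c (z r') \<in> cball (cmap c (z (- s))) r" for r'
  proof -
    obtain d where d: "((cmap c \<circ> y) has_vector_derivative d) (at (- r'))" "norm (d - w) \<le> \<eta>"
      using D[of "- r'"] r' by (auto simp: z_def)
    have "(uminus has_vector_derivative -1) (at r')"
      by (auto intro!: derivative_eq_intros simp flip: has_real_derivative_iff_has_vector_derivative)
    from vector_diff_chain_at[OF this d(1)]
    have "((cmap c \<circ> z) has_vector_derivative - d) (at r')" by (simp add: z_def o_assoc del: o_apply)
    then show ?thesis using d(2) by (intro exI[of _ "- d"]) (simp add: norm_minus_commute)
  qed
  ultimately have "z (- t) \<in> cdom c \<and> cmap c (z (- t)) \<in> cball (cmap c (z (- s))) r \<and>
    norm (cmap c (z (- t)) - cmap c (z (- s)) - (- t - (- s)) *\<^sub>R (- w)) \<le> \<eta> * (- t - (- s))"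
    using assms False by (intro chart_drift_forward) (auto simp: z)
  then show ?thesis using False by (simp add: z algebra_simps)
qed

text \<open>On a small ball around \<open>z\<close> the field \<open>V\<close> is nearly constant by continuity, and a perturbation of
  small Riemannian length is small in the chart, so the velocity stays within \<open>\<eta>\<close> of \<open>V c z\<close>. The
  constants are chosen before the curve. Since the conclusion mentions positions only and no
  velocities, it survives pointwise limits; for a limit curve through \<open>z\<close>, with \<open>\<eta>\<close> arbitrary, it
  says that the derivative is \<open>V c z\<close>.\<close>

lemma uniform_chart_drift:
  fixes A :: "('a::t2_space, 'e::{banach, heine_borel}) chart set"
  assumes "c \<in> A" and c: "is_chart c" and "z \<in> cdom c"
    and V: "continuous_on (cmap c ` cdom c) (V c \<circ> cinv c)"
    and dom: "\<exists>K>0. \<forall>\<^sub>F p in nhds (cmap c z). \<forall>u. norm u \<le> K * gnorm g c (cinv c p) u"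
    and "\<eta> > 0"
  obtains \<tau> \<epsilon> W C where "\<tau> > 0" "\<epsilon> > 0" "open W" "z \<in> W" "closed C" "C \<subseteq> cdom c"
    and "\<forall>v y s t. integral_curve A (\<lambda>c p. V c p + v c p) y \<longrightarrow>
       (\<forall>p\<in>cdom c. gnorm g c p (v c p) < \<epsilon>) \<longrightarrow> y s \<in> W \<longrightarrow> \<bar>t - s\<bar> \<le> \<tau> \<longrightarrow>
       y t \<in> C \<and> norm (cmap c (y t) - cmap c (y s) - (t - s) *\<^sub>R V c z) \<le> \<eta> * \<bar>t - s\<bar>"
proof -
  define S where "S = cmap c ` cdom c"
  define q where "q = cmap c z"
  define w where "w = V c z"
  have "open S" using c by (simp add: S_def is_chart_def)
  have "q \<in> S" using \<open>z \<in> cdom c\<close> by (simp add: S_def q_def)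
  obtain K where K: "K > 0" "\<forall>\<^sub>F p in nhds q. \<forall>u. norm u \<le> K * gnorm g c (cinv c p) u"
    using dom by (auto simp: q_def)
  have "((V c \<circ> cinv c) \<longlongrightarrow> (V c \<circ> cinv c) q) (nhds q)"
    using V \<open>q \<in> S\<close> \<open>open S\<close> unfolding tendsto_at_iff_tendsto_nhds[symmetric]
    by (simp add: S_def[symmetric] continuous_on_eq_continuous_at continuous_at del: o_apply)
  then have "\<forall>\<^sub>F p in nhds q. dist ((V c \<circ> cinv c) p) ((V c \<circ> cinv c) q) < \<eta> / 2"
    by (rule tendstoD) (use \<open>\<eta> > 0\<close> in simp)
  moreover have "\<forall>\<^sub>F p in nhds q. p \<in> S"
    using \<open>open S\<close> \<open>q \<in> S\<close> by (rule eventually_nhds_in_open)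
  ultimately have "\<forall>\<^sub>F p in nhds q. p \<in> S \<and> norm (V c (cinv c p) - w) \<le> \<eta> / 2 \<and>
      (\<forall>u. norm u \<le> K * gnorm g c (cinv c p) u)"
    using K(2)
    by eventually_elim
      (use is_chart_cinv(1)[OF c \<open>z \<in> cdom c\<close>] in \<open>auto simp: q_def w_def dist_norm\<close>)
  then obtain \<rho>' where \<rho>': "\<rho>' > 0" "\<And>p. dist p q < \<rho>' \<Longrightarrow> p \<in> S \<and> norm (V c (cinv c p) - w) \<le> \<eta> / 2 \<and>
      (\<forall>u. norm u \<le> K * gnorm g c (cinv c p) u)"
    unfolding eventually_nhds_metric by blast
  define \<rho> where "\<rho> = \<rho>' / 3"
  have "\<rho> > 0" using \<rho>'(1) by (simp add: \<rho>_def)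
  have near: "p \<in> S" "norm (V c (cinv c p) - w) \<le> \<eta> / 2" "norm u \<le> K * gnorm g c (cinv c p) u"
    if "p \<in> cball q (2 * \<rho>)" for p u
    using \<rho>'(2)[of p] that \<rho>'(1) by (auto simp: \<rho>_def dist_commute)
  \<comment> \<open>Within time \<open>\<tau>\<close> a speed of at most \<open>\<parallel>w\<parallel> + \<eta>\<close> covers a distance less than \<open>\<rho>\<close>, and a perturbation of
    Riemannian length less than \<open>\<epsilon>\<close> has norm at most \<open>\<eta> / 2\<close> in the chart.\<close>
  define \<tau> where "\<tau> = \<rho> / 2 / (norm w + \<eta>)"
  define \<epsilon> where "\<epsilon> = \<eta> / (2 * K)"
  have pos: "norm w + \<eta> > 0" using \<open>\<eta> > 0\<close> by (simp add: add_nonneg_pos)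
  have "\<tau> > 0" "\<epsilon> > 0" using pos \<open>\<rho> > 0\<close> \<open>\<eta> > 0\<close> \<open>K > 0\<close> by (auto simp: \<tau>_def \<epsilon>_def)
  have short: "(norm w + \<eta>) * \<tau> < \<rho>"
  proof -
    have "(norm w + \<eta>) * \<tau> = \<rho> / 2"
      using pos by (metis \<tau>_def less_irrefl mult.commute nonzero_eq_divide_eq)
    then show ?thesis using \<open>\<rho> > 0\<close> by simp
  qed
  define W where "W = {x \<in> cdom c. cmap c x \<in> ball q \<rho>}"
  define C where "C = {x \<in> cdom c. cmap c x \<in> cball q (2 * \<rho>)}"
  have W: "open W" "z \<in> W"
    using is_chart_open_preimage[OF c open_ball] \<open>z \<in> cdom c\<close> \<open>\<rho> > 0\<close>
    unfolding W_def q_def by (blast, simp)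
  have C: "closed C" "C \<subseteq> cdom c"
    using is_chart_closed_preimage_cball[OF c, of q "2 * \<rho>"] near(1) unfolding C_def S_def by blast+
  have "y t \<in> C \<and> norm (cmap c (y t) - cmap c (y s) - (t - s) *\<^sub>R V c z) \<le> \<eta> * \<bar>t - s\<bar>"
    if y: "integral_curve A (\<lambda>c p. V c p + v c p) y" and v: "\<forall>p\<in>cdom c. gnorm g c p (v c p) < \<epsilon>"
      and s: "y s \<in> W" and t: "\<bar>t - s\<bar> \<le> \<tau>" for v y s t
  proof -
    have sub: "cball (cmap c (y s)) \<rho> \<subseteq> cball q (2 * \<rho>)"
    proof
      fix p assume "p \<in> cball (cmap c (y s)) \<rho>"
      then show "p \<in> cball q (2 * \<rho>)"
        using s dist_triangle[of q p "cmap c (y s)"] by (auto simp: W_def)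
    qed
    have "y t \<in> cdom c \<and> cmap c (y t) \<in> cball (cmap c (y s)) \<rho> \<and>
      norm (cmap c (y t) - cmap c (y s) - (t - s) *\<^sub>R w) \<le> \<eta> * \<bar>t - s\<bar>"
    proof (rule chart_drift[OF c _ _ _ \<open>\<rho> > 0\<close> _ short _ t])
      show "continuous_on UNIV y" using y by (simp add: integral_curve_def)
      show "y s \<in> cdom c" using s by (simp add: W_def)
      show "cball (cmap c (y s)) \<rho> \<subseteq> cmap c ` cdom c" using sub near(1) by (auto simp: S_def)
      show "\<exists>d. ((cmap c \<circ> y) has_vector_derivative d) (at r) \<and> norm (d - w) \<le> \<eta>"
        if r: "y r \<in> cdom c" "cmap c (y r) \<in> cball (cmap c (y s)) \<rho>" for r
      proof (intro exI conjI)
        show "((cmap c \<circ> y) has_vector_derivative V c (y r) + v c (y r)) (at r)"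
          using y r \<open>c \<in> A\<close> by (simp add: integral_curve_def)
        have m: "cmap c (y r) \<in> cball q (2 * \<rho>)" using r sub by blast
        have "norm (v c (y r)) \<le> K * gnorm g c (y r) (v c (y r))"
          using near(3)[OF m] is_chart_cinv(1)[OF c r(1)] by simp
        also have "\<dots> \<le> K * \<epsilon>"
          using v r(1) \<open>K > 0\<close> by (intro mult_left_mono) (auto simp: less_imp_le)
        also have "\<dots> = \<eta> / 2" using \<open>K > 0\<close> by (simp add: \<epsilon>_def)
        finally have "norm (v c (y r)) \<le> \<eta> / 2" .
        moreover have "norm (V c (y r) - w) \<le> \<eta> / 2"
          using near(2)[OF m] is_chart_cinv(1)[OF c r(1)] by simp
        ultimately show "norm (V c (y r) + v c (y r) - w) \<le> \<eta>"
          using norm_triangle_ineq[of "V c (y r) - w" "v c (y r)"] by (simp add: algebra_simps)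
      qed
    qed (use \<open>\<eta> > 0\<close> in auto)
    then show ?thesis using sub by (auto simp: C_def w_def)
  qed
  then show thesis by (intro that[OF \<open>\<tau> > 0\<close> \<open>\<epsilon> > 0\<close> W C] allI impI)
qed


section \<open>Limits of perturbed integral curves\<close>

definition near_integral_curves ::
  "('a::topological_space, 'e::{banach, heine_borel}) chart set \<Rightarrow> ('a, 'e) metric \<Rightarrow>
     ('a, 'e) vfield \<Rightarrow> real \<Rightarrow> (real \<Rightarrow> 'a) set" where
  "near_integral_curves A g V \<epsilon> =
     {y. \<exists>v. integral_curve A (\<lambda>c p. V c p + v c p) y \<and> (\<forall>c\<in>A. \<forall>p\<in>cdom c. gnorm g c p (v c p) < \<epsilon>)}"

text \<open>The drift estimate, taken at \<open>z = x s\<close>, passes to the pointwise limit. That the drift estimate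
  also confines the curves to a closed subset of the chart keeps the limit inside the chart for a
  short time, and this yields the continuity of \<open>x\<close>, which pointwise convergence alone does not.\<close>

lemma near_integral_curves_limit:
  fixes A :: "('a::t2_space, 'e::{banach, heine_borel}) chart set"
  assumes chart: "\<And>c. c \<in> A \<Longrightarrow> is_chart c" and cover: "(\<Union>c\<in>A. cdom c) = UNIV"
    and V: "\<And>c. c \<in> A \<Longrightarrow> continuous_on (cmap c ` cdom c) (V c \<circ> cinv c)"
    and dom: "\<And>c z. c \<in> A \<Longrightarrow> z \<in> cdom c \<Longrightarrow>
      \<exists>K>0. \<forall>\<^sub>F p in nhds (cmap c z). \<forall>u. norm u \<le> K * gnorm g c (cinv c p) u"
    and "F \<noteq> bot" and lim: "\<And>t. ((\<lambda>y. y t) \<longlongrightarrow> x t) F"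
    and near: "\<And>\<epsilon>. \<epsilon> > 0 \<Longrightarrow> \<forall>\<^sub>F y in F. y \<in> near_integral_curves A g V \<epsilon>"
  shows "integral_curve A V x"
proof -
  have drift: "\<exists>\<tau>>0. \<forall>t. \<bar>t - s\<bar> \<le> \<tau> \<longrightarrow> x t \<in> cdom c \<and>
      norm (cmap c (x t) - cmap c (x s) - (t - s) *\<^sub>R V c (x s)) \<le> \<eta> * \<bar>t - s\<bar>"
    if cA: "c \<in> A" and xs: "x s \<in> cdom c" and "\<eta> > 0" for c s \<eta>
  proof -
    note c = chart[OF cA]
    obtain \<tau> \<epsilon> W C where "\<tau> > 0" "\<epsilon> > 0" "open W" "x s \<in> W" "closed C" "C \<subseteq> cdom c"
      and y: "\<forall>v y s' t. integral_curve A (\<lambda>c p. V c p + v c p) y \<longrightarrow>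
       (\<forall>p\<in>cdom c. gnorm g c p (v c p) < \<epsilon>) \<longrightarrow> y s' \<in> W \<longrightarrow> \<bar>t - s'\<bar> \<le> \<tau> \<longrightarrow>
       y t \<in> C \<and> norm (cmap c (y t) - cmap c (y s') - (t - s') *\<^sub>R V c (x s)) \<le> \<eta> * \<bar>t - s'\<bar>"
      by (rule uniform_chart_drift[where V = V and g = g, OF cA c xs V[OF cA] dom[OF cA xs] \<open>\<eta> > 0\<close>])
        (rule that; assumption)
    have "x t \<in> cdom c \<and>
      norm (cmap c (x t) - cmap c (x s) - (t - s) *\<^sub>R V c (x s)) \<le> \<eta> * \<bar>t - s\<bar>" if t: "\<bar>t - s\<bar> \<le> \<tau>" for t
    proof -
      have "\<forall>\<^sub>F y in F. y s \<in> W"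
        using lim[of s] \<open>open W\<close> \<open>x s \<in> W\<close> by (rule topological_tendstoD)
      with near[OF \<open>\<epsilon> > 0\<close>]
      have ev: "\<forall>\<^sub>F y in F. y t \<in> C \<and>
          norm (cmap c (y t) - cmap c (y s) - (t - s) *\<^sub>R V c (x s)) \<le> \<eta> * \<bar>t - s\<bar>"
      proof eventually_elim
        case (elim y')
        then obtain v where "integral_curve A (\<lambda>c p. V c p + v c p) y'"
          "\<forall>p\<in>cdom c. gnorm g c p (v c p) < \<epsilon>"
          using cA unfolding near_integral_curves_def by blast
        with y elim(2) t show ?case by simp
      qed
      have "\<forall>\<^sub>F y in F. y t \<in> C" using ev by eventually_elim simp
      then have "x t \<in> C" using Lim_in_closed_set[OF \<open>closed C\<close> _ \<open>F \<noteq> bot\<close> lim[of t]] by blast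
      then have xt: "x t \<in> cdom c" using \<open>C \<subseteq> cdom c\<close> by blast
      have cont: "((\<lambda>y. cmap c (y r)) \<longlongrightarrow> cmap c (x r)) F" if "x r \<in> cdom c" for r
      proof -
        have "isCont (cmap c) (x r)"
          using is_chart_continuous_on[OF c] c that
          by (simp add: is_chart_def continuous_on_eq_continuous_at)
        then show ?thesis using lim[of r] by (rule isCont_tendsto_compose)
      qed
      have "((\<lambda>y. norm (cmap c (y t) - cmap c (y s) - (t - s) *\<^sub>R V c (x s))) \<longlongrightarrow>
         norm (cmap c (x t) - cmap c (x s) - (t - s) *\<^sub>R V c (x s))) F"
        by (intro tendsto_intros cont xt xs)
      moreover have "\<forall>\<^sub>F y in F. norm (cmap c (y t) - cmap c (y s) - (t - s) *\<^sub>R V c (x s)) \<le> \<eta> * \<bar>t - s\<bar>"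
        using ev by eventually_elim simp
      ultimately show ?thesis using xt tendsto_upperbound \<open>F \<noteq> bot\<close> by blast
    qed
    then show ?thesis using \<open>\<tau> > 0\<close> by blast
  qed
  have D: "((cmap c \<circ> x) has_vector_derivative V c (x s)) (at s)" if cs: "c \<in> A" "x s \<in> cdom c" for c s
    unfolding has_vector_derivative_def has_derivative_within_alt
  proof (intro conjI allI impI)
    show "bounded_linear (\<lambda>r. r *\<^sub>R V c (x s))" by (rule bounded_linear_scaleR_left)
    fix \<eta> :: real assume "\<eta> > 0"
    then obtain \<tau> where "\<tau> > 0" "\<And>t. \<bar>t - s\<bar> \<le> \<tau> \<Longrightarrow>
      norm (cmap c (x t) - cmap c (x s) - (t - s) *\<^sub>R V c (x s)) \<le> \<eta> * \<bar>t - s\<bar>"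
      using drift[OF cs \<open>\<eta> > 0\<close>] by meson
    then show "\<exists>d>0. \<forall>t\<in>UNIV. norm (t - s) < d \<longrightarrow>
       norm ((cmap c \<circ> x) t - (cmap c \<circ> x) s - (t - s) *\<^sub>R V c (x s)) \<le> \<eta> * norm (t - s)"
      by (intro exI[of _ \<tau>]) auto
  qed
  have "isCont x s" for s
  proof -
    obtain c where c: "c \<in> A" "x s \<in> cdom c" using cover by blast
    note cc = chart[OF c(1)]
    obtain \<tau> where "\<tau> > 0" "\<And>t. \<bar>t - s\<bar> \<le> \<tau> \<Longrightarrow> x t \<in> cdom c"
      using drift[OF c zero_less_one] by meson
    then have ev: "\<forall>\<^sub>F t in at s. x t \<in> cdom c"
      unfolding eventually_at by (intro exI[of _ \<tau>]) (auto simp: dist_real_def)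
    have "((\<lambda>t. cmap c (x t)) \<longlongrightarrow> cmap c (x s)) (at s)"
      using has_vector_derivative_continuous[OF D[OF c]] by (simp add: continuous_at o_def)
    moreover have "open (cmap c ` cdom c)" "continuous_on (cmap c ` cdom c) (cinv c)"
      using cc by (simp_all add: is_chart_def homeomorphism_def)
    then have "isCont (cinv c) (cmap c (x s))"
      using c(2) continuous_on_eq_continuous_at by blast
    ultimately have "((\<lambda>t. cinv c (cmap c (x t))) \<longlongrightarrow> cinv c (cmap c (x s))) (at s)"
      using isCont_tendsto_compose by blast
    then have "((\<lambda>t. cinv c (cmap c (x t))) \<longlongrightarrow> x s) (at s)"
      using is_chart_cinv(1)[OF cc c(2)] by simp
    then show ?thesis
      unfolding continuous_at
      by (rule Lim_transform_eventually) (use ev is_chart_cinv(1)[OF cc] in \<open>auto elim: eventually_mono\<close>)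
  qed
  then show ?thesis
    using D by (simp add: integral_curve_def continuous_at_imp_continuous_on)
qed


section \<open>The gradient in charts\<close>

lemma smooth_manifold_basis:
  fixes A :: "('a::{t2_space, second_countable_topology}, 'e::{banach, heine_borel}) chart set"
  assumes "smooth_manifold A"
  obtains B :: "'e set" where "finite B" "independent B" "span B = UNIV"
proof -
  obtain E :: "'e set" where E: "finite E" "span E = UNIV"
    using assms by (auto simp: smooth_manifold_def)
  obtain B where "B \<subseteq> E" "independent B" "E \<subseteq> span B"
    using maximal_independent_subset by blast
  then have "span B = UNIV" using E(2) span_mono[of E "span B"] by (auto simp: span_span)
  then show thesis using that \<open>B \<subseteq> E\<close> \<open>independent B\<close> E(1) finite_subset by blast
qed

lemma riemannian_metric_in_chart:
  assumes "riemannian_metric A g" "c \<in> A" "is_chart c"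
  shows "p \<in> cmap c ` cdom c \<Longrightarrow> bilinear (g c (cinv c p))"
    and "p \<in> cmap c ` cdom c \<Longrightarrow> g c (cinv c p) u w = g c (cinv c p) w u"
    and "p \<in> cmap c ` cdom c \<Longrightarrow> u \<noteq> 0 \<Longrightarrow> g c (cinv c p) u u > 0"
    and "smooth_on (\<lambda>p. g c (cinv c p) u w) (cmap c ` cdom c)"
  using assms(1,2) is_chart_cinv(2)[OF assms(3)] unfolding riemannian_metric_def by blast+

text \<open>In a chart the gradient is the Riesz representation of the differential; the representing vector
  is unique because the metric is positive definite.\<close>

lemma gradient_smooth_combination:
  fixes A :: "('a::{t2_space, second_countable_topology}, 'e::{banach, heine_borel}) chart set"
  assumes "smooth_manifold A" "riemannian_metric A g" "smooth_function A f" "c \<in> A"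
  shows "\<exists>B. smooth_combination B (cmap c ` cdom c) (\<lambda>p. gradient g f c (cinv c p))"
proof -
  have c: "is_chart c" using assms by (simp add: smooth_manifold_def)
  have "open (cmap c ` cdom c)" using c by (simp add: is_chart_def)
  obtain B :: "'e set" where B: "finite B" "independent B" "span B = UNIV"
    using smooth_manifold_basis[OF assms(1)] .
  note m = riemannian_metric_in_chart[OF assms(2,4) c]
  have f: "smooth_on (f \<circ> cinv c) (cmap c ` cdom c)"
    using assms by (simp add: smooth_function_def)
  obtain V where V: "smooth_combination B (cmap c ` cdom c) V"
      "\<And>p u. p \<in> cmap c ` cdom c \<Longrightarrow> g c (cinv c p) (V p) u = frechet_derivative (f \<circ> cinv c) (at p) u"
    using smooth_Riesz_representation[of "cmap c ` cdom c" B "\<lambda>p. g c (cinv c p)"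
        "\<lambda>p. frechet_derivative (f \<circ> cinv c) (at p)",
        OF \<open>open (cmap c ` cdom c)\<close> B(1,2) m
          has_derivative_linear[OF smooth_on_has_derivative[OF f]] smooth_on_frechet_derivative[OF f]]
    unfolding B(3) by blast
  have "gradient g f c (cinv c p) = V p" if p: "p \<in> cmap c ` cdom c" for p
    unfolding gradient_def differential_def is_chart_cinv(3)[OF c p]
  proof (rule the_equality)
    show "\<forall>u. g c (cinv c p) (V p) u = frechet_derivative (f \<circ> cinv c) (at p) u"
      using V(2)[OF p] by simp
    fix z assume "\<forall>u. g c (cinv c p) z u = frechet_derivative (f \<circ> cinv c) (at p) u"
    then have "g c (cinv c p) (z - V p) (z - V p) = 0"
      by (simp add: V(2)[OF p] bilinear_lsub[OF m(1)[OF p]])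
    then show "z = V p" using m(3)[OF p, of "z - V p"] by auto
  qed
  then have "smooth_combination B (cmap c ` cdom c) (\<lambda>p. gradient g f c (cinv c p))"
    by (rule smooth_combination_cong[OF _ V(1)])
  then show ?thesis by blast
qed

lemma smooth_combination_uminus:
  assumes "open S" "smooth_combination B S V"
  shows "smooth_combination B S (\<lambda>p. - V p)"
proof -
  obtain \<alpha> where \<alpha>: "\<And>b. smooth_on (\<alpha> b) S" "\<And>p. p \<in> S \<Longrightarrow> V p = (\<Sum>b\<in>B. \<alpha> b p *\<^sub>R b)"
    using assms(2) unfolding smooth_combination_def by blast
  have "smooth_on (\<lambda>p. (- 1) *\<^sub>R \<alpha> b p) S" for b
    by (intro smooth_on_scaleR smooth_on_const assms(1) \<alpha>)
  then show ?thesis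
    unfolding smooth_combination_def
    by (intro exI[of _ "\<lambda>b p. (- 1) *\<^sub>R \<alpha> b p"]) (simp add: \<alpha>(2) sum_negf)
qed

lemma riemannian_metric_locally_dominates_norm:
  fixes A :: "('a::{t2_space, second_countable_topology}, 'e::{banach, heine_borel}) chart set"
  assumes "smooth_manifold A" "riemannian_metric A g" "c \<in> A" "z \<in> cdom c"
  shows "\<exists>K>0. \<forall>\<^sub>F p in nhds (cmap c z). \<forall>u. norm u \<le> K * gnorm g c (cinv c p) u"
proof -
  have c: "is_chart c" using assms by (simp add: smooth_manifold_def)
  have "open (cmap c ` cdom c)" using c by (simp add: is_chart_def)
  obtain B :: "'e set" where B: "finite B" "independent B" "span B = UNIV"
    using smooth_manifold_basis[OF assms(1)] .
  show ?thesis
    unfolding gnorm_def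
    by (rule norm_locally_dominated[where \<gamma> = "\<lambda>p. g c (cinv c p)", OF \<open>open (cmap c ` cdom c)\<close> B
          riemannian_metric_in_chart[OF assms(2,3) c]]) (use assms(4) in auto)
qed

lemma smooth_function_continuous:
  assumes "smooth_manifold A" "smooth_function A f"
  shows "continuous_on UNIV f"
proof -
  have "isCont f z" for z
  proof -
    have "z \<in> (\<Union>c\<in>A. cdom c)" using assms(1) by (simp add: smooth_manifold_def)
    then obtain c where c: "c \<in> A" "z \<in> cdom c" "is_chart c"
      using assms(1) unfolding smooth_manifold_def by blast
    have "continuous_on (cmap c ` cdom c) (f \<circ> cinv c)"
      using assms(2) c(1) by (intro smooth_on_imp_continuous_on) (simp add: smooth_function_def del: o_apply)
    then have "continuous_on (cdom c) ((f \<circ> cinv c) \<circ> cmap c)"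
      by (rule continuous_on_compose[OF is_chart_continuous_on[OF c(3)]])
    then have "continuous_on (cdom c) f"
      by (rule continuous_on_cong[THEN iffD1, rotated -1]) (auto simp: is_chart_cinv(1)[OF c(3)])
    then show ?thesis
      using c by (simp add: is_chart_def continuous_on_eq_continuous_at)
  qed
  then show ?thesis by (simp add: continuous_at_imp_continuous_on)
qed

lemma integral_curve_smooth:
  assumes "\<And>c. c \<in> A \<Longrightarrow> is_chart c"
    and V: "\<And>c. c \<in> A \<Longrightarrow> \<exists>B. smooth_combination B (cmap c ` cdom c) (\<lambda>p. V c (cinv c p))"
    and x: "integral_curve A V x"
  shows "x \<in> smooth_curves A"
  unfolding smooth_curves_def
proof (intro CollectI conjI ballI)
  show "continuous_on UNIV x" using x by (simp add: integral_curve_def)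
  fix c assume "c \<in> A"
  note c = assms(1)[OF this]
  obtain B where B: "smooth_combination B (cmap c ` cdom c) (\<lambda>p. V c (cinv c p))"
    using V[OF \<open>c \<in> A\<close>] by blast
  have op: "open (cdom c)" "open (cmap c ` cdom c)" using c by (auto simp: is_chart_def)
  have "open (x -` cdom c)"
    using \<open>continuous_on UNIV x\<close> op(1) by (simp add: continuous_on_open_vimage)
  moreover have "((cmap c \<circ> x) has_vector_derivative V c (cinv c ((cmap c \<circ> x) s))) (at s)"
    if "s \<in> x -` cdom c" for s
    using x that \<open>c \<in> A\<close> is_chart_cinv(1)[OF c, of "x s"] by (simp add: integral_curve_def)
  moreover have "(cmap c \<circ> x) ` (x -` cdom c) \<subseteq> cmap c ` cdom c" by auto
  ultimately have "smooth_on (\<lambda>s. (cmap c \<circ> x) s) (x -` cdom c)"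
    by (intro smooth_on_integral_curve[OF op(2) _ _ B _ smooth_on_id[OF op(2)]])
  then show "smooth_on (cmap c \<circ> x) (x -` cdom c)" .
qed

lemma integral_curve_shift:
  assumes "integral_curve A V x"
  shows "integral_curve A V (\<lambda>t. x (t + s))"
  unfolding integral_curve_def
proof (intro conjI allI ballI impI)
  show "continuous_on UNIV (\<lambda>t. x (t + s))"
    by (rule continuous_on_compose2[of UNIV x])
      (use assms in \<open>auto simp: integral_curve_def intro!: continuous_intros\<close>)
  fix t c assume "c \<in> A" "x (t + s) \<in> cdom c"
  then have d: "((cmap c \<circ> x) has_vector_derivative V c (x (t + s))) (at (t + s))"
    using assms by (simp add: integral_curve_def)
  have "((\<lambda>t. t + s) has_vector_derivative 1) (at t)"
    by (auto intro!: derivative_eq_intros simp flip: has_real_derivative_iff_has_vector_derivative)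
  from vector_diff_chain_at[OF this d]
  show "(cmap c \<circ> (\<lambda>t. x (t + s)) has_vector_derivative V c (x (t + s))) (at t)"
    by (simp add: o_def)
qed

text \<open>The summand of order \<open>0\<close> already bounds \<open>v\<close>. It is at most the whole norm because each supremum
  is nonnegative, being taken over a nonempty set of lengths.\<close>

lemma gnorm_le_Ck_norm:
  assumes "riemannian_metric A g" "v \<in> Vk A g k U" "c \<in> A" "p \<in> cdom c"
  shows "gnorm g c p (v c p) \<le> Ck_norm A g k v"
proof -
  have bil: "bilinear (g c q)" and pos: "u \<noteq> 0 \<Longrightarrow> g c q u u > 0" if "c \<in> A" "q \<in> cdom c" for c q u
    using assms(1) that unfolding riemannian_metric_def by blast+
  have g0: "gnorm g c q 0 = 0" if "c \<in> A" "q \<in> cdom c" for c q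
    by (simp add: gnorm_def bilinear_lzero[OF bil[OF that]])
  have nonneg: "gnorm g c q u \<ge> 0" if "c \<in> A" "q \<in> cdom c" for c q u
    using pos[OF that, of u] g0[OF that] by (cases "u = 0") (simp_all add: gnorm_def)
  have bdd: "bdd_above (nabla_values A g j v)" if "j \<le> k" for j
    using assms(2) that by (simp add: Vk_def)
  have "0 \<le> Sup (nabla_values A g j v)" if "j \<le> k" for j
  proof -
    have "gnorm g c p (nabla g j v c (replicate j 0) p) \<in> nabla_values A g j v"
      unfolding nabla_values_def using assms(3,4) g0
      by (intro CollectI exI[of _ c] exI[of _ p] exI[of _ "replicate j 0"]) auto
    then show ?thesis
      using cSup_upper[OF _ bdd[OF that]] nonneg[OF assms(3,4)] order_trans by blast
  qed
  then have "Sup (nabla_values A g 0 v) \<le> Ck_norm A g k v"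
    unfolding Ck_norm_def by (intro member_le_sum) auto
  moreover have "gnorm g c p (v c p) \<in> nabla_values A g 0 v"
    unfolding nabla_values_def nabla_def using assms(3,4)
    by (intro CollectI exI[of _ c] exI[of _ p] exI[of _ "[]"]) auto
  then have "gnorm g c p (v c p) \<le> Sup (nabla_values A g 0 v)"
    by (rule cSup_upper) (simp add: bdd)
  ultimately show ?thesis by linarith
qed


section \<open>Confinement of perturbed gradient lines\<close>

theorem lemmaA1:
  fixes A :: "('a::{t2_space, second_countable_topology}, 'e::{banach, heine_borel}) chart set"
    and g :: "('a, 'e) metric"
    and f :: "'a \<Rightarrow> real"
    and a b \<delta> :: real
    and U :: "'a \<Rightarrow> 'a set"
    and N :: "'a set"
    and k :: nat
  assumes manifold: "smooth_manifold A" "connected (UNIV :: 'a set)"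
    and metric: "riemannian_metric A g"
    and morse: "morse_function A f"
    and compactness: "\<And>a' b'. a' \<le> b' \<Longrightarrow> compactin (Cinf_loc_topology A) (grad_lines A g f a' b')"
    and "a < b"
    and U_nbhd: "\<And>p. p \<in> crit_between A f a b \<Longrightarrow> open (U p) \<and> p \<in> U p"
    and U_disjoint: "\<And>p q. p \<in> crit_between A f a b \<Longrightarrow> q \<in> crit_between A f a b \<Longrightarrow> p \<noteq> q \<Longrightarrow>
          closure (U p) \<inter> closure (U q) = {}"
    and N_nbhd: "open N" "{x 0 | x. x \<in> grad_lines A g f a b} \<subseteq> N"
    and N_bounded: "compact (closure N)"
    and "\<delta> > 0"
    and grad_bound: "\<And>c x. c \<in> A \<Longrightarrow> x \<in> cdom c \<Longrightarrow> x \<in> N - (\<Union>p \<in> crit_between A f a b. U p) \<Longrightarrow>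
          gnorm g c x (gradient g f c x) \<ge> \<delta>"
    and "k \<ge> 2"
    and k_index: "\<And>p q. p \<in> crit_between A f a b \<Longrightarrow> q \<in> crit_between A f a b \<Longrightarrow>
          int k > int (morse_index A f p) - int (morse_index A f q)"
  shows "\<exists>\<epsilon>. 0 < \<epsilon> \<and> \<epsilon> < \<delta> \<and>
           (\<forall>v \<in> Vk A g k (\<Union>p \<in> crit_between A f a b. U p). Ck_norm A g k v < \<epsilon> \<longrightarrow>
              (\<forall>x \<in> perturbed_lines A g f a b v (closure N). range x \<subseteq> N))"
proof (rule ccontr)
  assume contra: "\<not> ?thesis"
  define V where "V c p = - gradient g f c p" for c p
  have f: "smooth_function A f" using morse by (simp add: morse_function_def)
  have chart: "is_chart c" if "c \<in> A" for c using manifold(1) that by (simp add: smooth_manifold_def)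
  have cover: "(\<Union>c\<in>A. cdom c) = UNIV" using manifold(1) by (simp add: smooth_manifold_def)
  have smooth_V: "\<exists>B. smooth_combination B (cmap c ` cdom c) (\<lambda>p. V c (cinv c p))" if "c \<in> A" for c
    unfolding V_def
    using gradient_smooth_combination[OF manifold(1) metric f that] smooth_combination_uminus
      is_chart_def[THEN iffD1, OF chart[OF that]] by blast
  \<comment> \<open>Shifting time makes the curves that leave \<open>N\<close> do so at time \<open>0\<close>, so that this survives in the
    limit as a condition at a single time.\<close>
  define P where "P \<epsilon> = {y \<in> near_integral_curves A g V \<epsilon>.
    (\<forall>s. y s \<in> closure N \<and> a \<le> f (y s) \<and> f (y s) \<le> b) \<and> y 0 \<notin> N}" for \<epsilon>
  have P_mono: "P \<epsilon> \<subseteq> P \<epsilon>'" if "\<epsilon> \<le> \<epsilon>'" for \<epsilon> \<epsilon>'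
    using that unfolding P_def near_integral_curves_def by fastforce
  have P_ne: "P \<epsilon> \<noteq> {}" if "\<epsilon> > 0" for \<epsilon>
  proof -
    define \<epsilon>' where "\<epsilon>' = min \<epsilon> (\<delta> / 2)"
    have "0 < \<epsilon>'" "\<epsilon>' < \<delta>" "\<epsilon>' \<le> \<epsilon>" using that \<open>\<delta> > 0\<close> by (auto simp: \<epsilon>'_def)
    then obtain v x s where v: "v \<in> Vk A g k (\<Union>p \<in> crit_between A f a b. U p)" "Ck_norm A g k v < \<epsilon>'"
      and x: "x \<in> perturbed_lines A g f a b v (closure N)" "x s \<notin> N"
      using contra by blast
    have "integral_curve A (\<lambda>c p. V c p + v c p) (\<lambda>t. x (t + s))"
      using x(1) by (intro integral_curve_shift) (simp add: perturbed_lines_def V_def)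
    moreover have "gnorm g c p (v c p) < \<epsilon>'" if "c \<in> A" "p \<in> cdom c" for c p
      using gnorm_le_Ck_norm[OF metric v(1) that] v(2) by linarith
    ultimately have "(\<lambda>t. x (t + s)) \<in> P \<epsilon>'"
      using x unfolding P_def near_integral_curves_def perturbed_lines_def by auto
    then show ?thesis using P_mono[OF \<open>\<epsilon>' \<le> \<epsilon>\<close>] by blast
  qed
  \<comment> \<open>The sets \<open>P \<epsilon>\<close> shrink with \<open>\<epsilon>\<close>, so they form a filter base. A filter replaces a sequence of
    curves because an uncountable product of compact spaces need not be sequentially compact.\<close>
  define F0 where "F0 = (INF \<epsilon>\<in>{0<..}. principal (P \<epsilon>))"
  have ev_F0: "eventually Q F0 \<longleftrightarrow> (\<exists>\<epsilon>>0. \<forall>y\<in>P \<epsilon>. Q y)" for Q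
    unfolding F0_def
  proof (subst eventually_INF_base)
    fix \<epsilon> \<epsilon>' :: real assume "\<epsilon> \<in> {0<..}" "\<epsilon>' \<in> {0<..}"
    then show "\<exists>e\<in>{0<..}. principal (P e) \<le> inf (principal (P \<epsilon>)) (principal (P \<epsilon>'))"
      by (intro bexI[of _ "min \<epsilon> \<epsilon>'"]) (auto intro: P_mono[THEN subsetD, rotated])
  qed (auto simp: eventually_principal)
  have "F0 \<noteq> bot"
    using ev_F0[of "\<lambda>_. False"] P_ne by (auto simp: trivial_limit_def)
  have "compact (\<Pi>\<^sub>E t\<in>(UNIV :: real set). closure N)"
    using N_bounded unfolding compactin_euclidean_iff[symmetric] euclidean_product_topology[symmetric]
    by (simp add: compactin_PiE)
  moreover have "eventually (\<lambda>y. y \<in> (\<Pi>\<^sub>E t\<in>(UNIV :: real set). closure N)) F0"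
    unfolding ev_F0 by (intro exI[of _ 1]) (auto simp: P_def PiE_def)
  ultimately obtain x where x: "inf (nhds x) F0 \<noteq> bot"
    using \<open>F0 \<noteq> bot\<close> unfolding compact_filter by blast
  define F where "F = inf (nhds x) F0"
  have "F \<noteq> bot" using x by (simp add: F_def)
  have ev_F: "\<forall>\<^sub>F y in F. y \<in> P \<epsilon>" if "\<epsilon> > 0" for \<epsilon>
  proof -
    have "\<forall>\<^sub>F y in F0. y \<in> P \<epsilon>" using that ev_F0 by blast
    then show ?thesis unfolding F_def using filter_leD inf_le2 by blast
  qed
  have lim: "((\<lambda>y. y t) \<longlongrightarrow> x t) F" for t
  proof -
    have "((\<lambda>y. y t) \<longlongrightarrow> x t) (nhds x)"
    proof (rule topological_tendstoI)
      fix W assume W: "open W" "x t \<in> W"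
      have "continuous_on UNIV (\<lambda>y :: real \<Rightarrow> 'a. y t)" by simp
      from open_vimage[OF W(1) this] W(2) show "\<forall>\<^sub>F y in nhds x. y t \<in> W"
        unfolding eventually_nhds by (intro exI[of _ "(\<lambda>y. y t) -` W"]) auto
    qed
    then show ?thesis unfolding F_def by (rule tendsto_mono[OF inf_le1])
  qed
  have "integral_curve A V x"
  proof (rule near_integral_curves_limit[OF chart cover _ _ \<open>F \<noteq> bot\<close> lim])
    show "continuous_on (cmap c ` cdom c) (V c \<circ> cinv c)" if "c \<in> A" for c
      using smooth_V[OF that] smooth_combination_imp_smooth_on smooth_on_imp_continuous_on chart[OF that]
      unfolding is_chart_def o_def by blast
    show "\<exists>K>0. \<forall>\<^sub>F p in nhds (cmap c z). \<forall>u. norm u \<le> K * gnorm g c (cinv c p) u"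
      if "c \<in> A" "z \<in> cdom c" for c z
      using riemannian_metric_locally_dominates_norm[OF manifold(1) metric that] .
    show "\<forall>\<^sub>F y in F. y \<in> near_integral_curves A g V \<epsilon>" if "\<epsilon> > 0" for \<epsilon>
      using ev_F[OF that] by eventually_elim (simp add: P_def)
  qed
  moreover from this have "x \<in> smooth_curves A"
    using integral_curve_smooth[OF chart smooth_V] by blast
  moreover have "a \<le> f (x s) \<and> f (x s) \<le> b" for s
  proof -
    have "isCont f (x s)"
      using smooth_function_continuous[OF manifold(1) f] by (simp add: continuous_on_eq_continuous_at)
    then have lf: "((\<lambda>y. f (y s)) \<longlongrightarrow> f (x s)) F" using lim[of s] by (rule isCont_tendsto_compose)
    have "\<forall>\<^sub>F y in F. a \<le> f (y s)" "\<forall>\<^sub>F y in F. f (y s) \<le> b"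
      using ev_F[OF zero_less_one] by (eventually_elim, simp add: P_def)+
    then show ?thesis
      using tendsto_lowerbound[OF lf] tendsto_upperbound[OF lf] \<open>F \<noteq> bot\<close> by blast
  qed
  ultimately have "x \<in> grad_lines A g f a b" by (simp add: grad_lines_def V_def[abs_def])
  then have "x 0 \<in> N" using N_nbhd(2) by blast
  moreover have "\<forall>\<^sub>F y in F. y 0 \<in> - N"
    using ev_F[OF zero_less_one] by eventually_elim (simp add: P_def)
  then have "x 0 \<in> - N"
    using Lim_in_closed_set[OF _ _ \<open>F \<noteq> bot\<close> lim[of 0]] N_nbhd(1) by blast
  ultimately show False by blast
qed

end
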